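(* Let $K$ be a field, $n>2$ an integer, $G$ a connected simple graph on $[n]=\{1,\ldots,n\}$, $S=K[X_i,Y_i\mid 1\le i\le n]$, and $I_G=\left([i,j]\mid\{i,j\}\text{ is an edge of }G\right)\subset S$, where $[i,j]=X_iY_j-Y_iX_j$. If $G$ has a Hamilton cycle, then $\operatorname{Assh}_S S/I_G=\{I_2(X)\}$.
   Context: A simple graph has no loops and no multiple edges. A Hamilton cycle is a cycle of $G$ passing through every vertex of $[n]$ exactly once. $I_2(X)=([i,j]\mid 1\le i<j\le n)$ is the ideal generated by all $2$-minors of the generic matrix $X=\begin{pmatrix} X_1 & \cdots & X_n \\ Y_1 & \cdots & Y_n \end{pmatrix}$. For an ideal $I$ of $S$, $\operatorname{Assh}_S S/I=\{P\in\operatorname{Spec}S\mid P\supset I\text{ and }\operatorname{ht}I=\operatorname{ht}P\}$, where $\operatorname{ht}$ denotes height. *)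

theory Defs
  imports
    "HOL-Algebra.Ideal"
    "HOL-Library.Poly_Mapping"
    "HOL-Library.Extended_Nat"
    "Graph_Theory.Graph_Theory"
begin

section \<open>Heights of ideals and \<open>Assh\<close>\<close>

definition Spec :: "('a, 'b) ring_scheme \<Rightarrow> 'a set set" where
  "Spec R = {P. primeideal P R}"

text \<open>Supremum of the lengths \<open>k\<close> of the strict chains \<open>C 0 \<subset> \<dots> \<subset> C k = P\<close> of prime ideals.\<close>

definition prime_height :: "('a, 'b) ring_scheme \<Rightarrow> 'a set \<Rightarrow> enat" where
  "prime_height R P =
     Sup {enat k | k C. (\<forall>i\<le>k. C i \<in> Spec R) \<and> (\<forall>i<k. C i \<subset> C (Suc i)) \<and> C k = P}"

text \<open>The infimum is \<open>\<infinity>\<close> if no prime ideal contains \<open>I\<close>, i.e. for the unit ideal.\<close>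

definition height :: "('a, 'b) ring_scheme \<Rightarrow> 'a set \<Rightarrow> enat" where
  "height R I = (INF P \<in> {P \<in> Spec R. I \<subseteq> P}. prime_height R P)"

lemma prime_height_mono:
  assumes "Q \<in> Spec R" "P \<subseteq> Q"
  shows "prime_height R P \<le> prime_height R Q"
proof (cases "P = Q")
  case False
  show ?thesis
    unfolding prime_height_def
  proof (rule Sup_mono, clarify)
    fix k C
    assume C: "\<forall>i\<le>k. C i \<in> Spec R" "\<forall>i<k. C i \<subset> C (Suc i)" "P = C k"
    let ?D = "C(Suc k := Q)"
    have "\<forall>i\<le>Suc k. ?D i \<in> Spec R" "\<forall>i<Suc k. ?D i \<subset> ?D (Suc i)" "?D (Suc k) = Q"
      using C assms False by (auto simp: le_Suc_eq less_Suc_eq)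
    then show "\<exists>b\<in>{enat k | k C. (\<forall>i\<le>k. C i \<in> Spec R) \<and> (\<forall>i<k. C i \<subset> C (Suc i)) \<and> C k = Q}.
        enat k \<le> b"
      by (intro bexI[of _ "enat (Suc k)"]) (auto simp del: fun_upd_apply)
  qed
qed simp

lemma height_prime: "P \<in> Spec R \<Longrightarrow> height R P = prime_height R P"
  unfolding height_def by (rule antisym) (auto intro: INF_lower INF_greatest prime_height_mono)

text \<open>\<open>Assh R I\<close> is the set written \<open>Assh\<^sub>R R/I\<close> in the literature.\<close>

definition Assh :: "('a, 'b) ring_scheme \<Rightarrow> 'a set \<Rightarrow> 'a set set" where
  "Assh R I = {P \<in> Spec R. I \<subseteq> P \<and> height R I = height R P}"


section \<open>Polynomial rings\<close>

text \<open>A polynomial is a finitely supported map from monomials to coefficients, a monomial a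
  finitely supported map from variables to exponents.\<close>

type_synonym ('v, 'k) mpoly = "('v \<Rightarrow>\<^sub>0 nat) \<Rightarrow>\<^sub>0 'k"

definition indet :: "'v \<Rightarrow> ('v, 'k::comm_ring_1) mpoly" where
  "indet v = Poly_Mapping.single (Poly_Mapping.single v 1) 1"

text \<open>\<open>poly_ring V\<close> is \<open>'k[V]\<close>: only the variables in \<open>V\<close>, not all those of type \<open>'v\<close>, occur.\<close>

definition poly_ring :: "'v set \<Rightarrow> ('v, 'k::comm_ring_1) mpoly ring" where
  "poly_ring V =
     \<lparr>carrier = {p. \<forall>m \<in> Poly_Mapping.keys p. Poly_Mapping.keys m \<subseteq> V},
      monoid.mult = (*), one = 1, zero = 0, add = (+)\<rparr>"

lemma cring_poly_ring: "cring (poly_ring V :: ('v, 'k::comm_ring_1) mpoly ring)"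
proof -
  let ?C = "{p :: ('v, 'k) mpoly. \<forall>m \<in> Poly_Mapping.keys p. Poly_Mapping.keys m \<subseteq> V}"
  have add: "p + q \<in> ?C" if pq: "p \<in> ?C" "q \<in> ?C" for p q
  proof (intro CollectI ballI)
    fix m assume "m \<in> Poly_Mapping.keys (p + q)"
    then have "m \<in> Poly_Mapping.keys p \<union> Poly_Mapping.keys q"
      by (rule subsetD[OF keys_add])
    then show "Poly_Mapping.keys m \<subseteq> V"
      using pq by auto
  qed
  have mult: "p * q \<in> ?C" if pq: "p \<in> ?C" "q \<in> ?C" for p q
  proof (intro CollectI ballI)
    fix m assume "m \<in> Poly_Mapping.keys (p * q)"
    then have "m \<in> {a + b | a b. a \<in> Poly_Mapping.keys p \<and> b \<in> Poly_Mapping.keys q}"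
      by (rule subsetD[OF keys_mult])
    then obtain a b where ab: "a \<in> Poly_Mapping.keys p" "b \<in> Poly_Mapping.keys q" and m: "m = a + b"
      by auto
    have "Poly_Mapping.keys m \<subseteq> Poly_Mapping.keys a \<union> Poly_Mapping.keys b"
      unfolding m by (rule keys_add)
    also have "\<dots> \<subseteq> V"
      using pq ab by simp
    finally show "Poly_Mapping.keys m \<subseteq> V" .
  qed
  have uminus: "- p \<in> ?C" if "p \<in> ?C" for p
    using that by simp
  show ?thesis
    unfolding poly_ring_def
    by (intro cringI abelian_groupI comm_monoidI; unfold partial_object.simps monoid.simps ring.simps)
       ((rule add mult; assumption) | (rule bexI[OF _ uminus], simp, assumption)
         | simp add: algebra_simps)+
qed


section \<open>The generic matrix and its minors\<close>

text \<open>The variables are the positions of the generic \<open>2 \<times> n\<close> matrix: \<open>(1, i)\<close> stands for \<open>X\<^sub>i\<close> and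
  \<open>(2, i)\<close> for \<open>Y\<^sub>i\<close>.\<close>

type_synonym 'k matpoly = "(nat \<times> nat, 'k) mpoly"

definition X_var :: "nat \<Rightarrow> 'k::field matpoly" where
  "X_var i = indet (1, i)"

definition Y_var :: "nat \<Rightarrow> 'k::field matpoly" where
  "Y_var i = indet (2, i)"

definition S_ring :: "nat \<Rightarrow> 'k::field matpoly ring" where
  "S_ring n = poly_ring ({1, 2} \<times> {1..n})"

definition minor :: "nat \<Rightarrow> nat \<Rightarrow> 'k::field matpoly" where
  "minor i j = X_var i * Y_var j - Y_var i * X_var j"

lemma minor_in_carrier:
  assumes "i \<in> {1..n}" "j \<in> {1..n}"
  shows "(minor i j :: 'k::field matpoly) \<in> carrier (S_ring n)"
proof -
  interpret cring "S_ring n :: 'k matpoly ring"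
    unfolding S_ring_def by (rule cring_poly_ring)
  have closed: "p * q \<in> carrier (S_ring n)" if "p \<in> carrier (S_ring n)" "q \<in> carrier (S_ring n)"
    for p q :: "'k matpoly"
    using m_closed[OF that] by (simp add: S_ring_def poly_ring_def)
  have diff: "p - q \<in> carrier (S_ring n)" if "p \<in> carrier (S_ring n)" "q \<in> carrier (S_ring n)"
    for p q :: "'k matpoly"
    using that keys_diff[of p q] unfolding S_ring_def poly_ring_def partial_object.simps by blast
  have XY: "(X_var k :: 'k matpoly) \<in> carrier (S_ring n)"
    "(Y_var k :: 'k matpoly) \<in> carrier (S_ring n)" if "k \<in> {1..n}" for k
    using that by (simp_all add: X_var_def Y_var_def S_ring_def indet_def poly_ring_def)
  show ?thesis
    unfolding minor_def by (intro diff closed XY assms)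
qed

definition I2 :: "nat \<Rightarrow> 'k::field matpoly set" where
  "I2 n = Idl\<^bsub>S_ring n\<^esub> {minor i j | i j. 1 \<le> i \<and> i < j \<and> j \<le> n}"


section \<open>Graphs\<close>

text \<open>The locale predicate \<^const>\<open>Digraph.graph\<close> describes finite simple graphs, as symmetric
  loopfree digraphs without parallel arcs; \<open>{i, j}\<close> is an edge iff \<open>(i, j) \<in> arcs_ends G\<close>.
  Each edge thus contributes both \<open>minor i j\<close> and \<open>minor j i = - minor i j\<close>.\<close>

definition edge_ideal :: "nat \<Rightarrow> (nat, 'e) pre_digraph \<Rightarrow> 'k::field matpoly set" where
  "edge_ideal n G = Idl\<^bsub>S_ring n\<^esub> {minor i j | i j. (i, j) \<in> arcs_ends G}"

text \<open>\<^const>\<open>pre_digraph.cycle\<close> forbids repeated vertices but admits the closed walk \<open>u, v, u\<close>,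
  which is not a cycle of an undirected graph; hence the bound on the length.\<close>

definition has_hamilton_cycle :: "('v, 'e) pre_digraph \<Rightarrow> bool" where
  "has_hamilton_cycle G \<longleftrightarrow>
     (\<exists>p. pre_digraph.cycle G p \<and> 3 \<le> length p \<and> tail G ` set p = verts G)"

end

theory Submission
  imports Defs "HOL-Library.Product_Lexorder"
begin

text \<open>Let \<open>P\<close> be a prime containing \<open>I\<^sub>G\<close> and let \<open>U\<close> be the set of vertices \<open>i\<close> with
  \<open>X\<^sub>i, Y\<^sub>i \<in> P\<close>. Since \<open>X\<^sub>j [i, k] = X\<^sub>i [j, k] + X\<^sub>k [i, j]\<close>, and likewise for \<open>Y\<^sub>j\<close>, if \<open>U\<close> is empty
  then membership in \<open>P\<close> spreads from the minors of edges of the Hamilton cycle to all minors. Otherwise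
  \<open>ht P \<ge> n\<close>: traverse the cycle from a vertex of \<open>U\<close>, and consider the prime ideals generated by
  \<open>P \<inter> k[W]\<close> for the sets \<open>W\<close> of variables seen so far. A vertex of \<open>U\<close> contributes at least two
  strict inclusions, and a vertex outside \<open>U\<close> contributes at least one unless its predecessor is in
  \<open>U\<close>.

  On the other hand, \<open>I\<^sub>2(X)\<close> is the kernel of \<open>X\<^sub>i \<mapsto> s t\<^sub>i\<close>, \<open>Y\<^sub>i \<mapsto> t\<^sub>i\<close>, hence prime, and it meets
  \<open>k[X\<^sub>1, \<dots>, X\<^sub>n, Y\<^sub>1]\<close> trivially, so its height is at most \<open>2n - (n + 1) = n - 1\<close>.\<close>

section \<open>Ideals of polynomial rings\<close>

lemma poly_ring_simps [simp]:
  "p \<otimes>\<^bsub>poly_ring V\<^esub> q = p * q" "p \<oplus>\<^bsub>poly_ring V\<^esub> q = p + q"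
  "\<one>\<^bsub>poly_ring V\<^esub> = 1" "\<zero>\<^bsub>poly_ring V\<^esub> = 0"
  by (simp_all add: poly_ring_def)

lemma carrier_poly_ring:
  "p \<in> carrier (poly_ring V) \<longleftrightarrow> (\<forall>m\<in>Poly_Mapping.keys p. Poly_Mapping.keys m \<subseteq> V)"
  by (simp add: poly_ring_def)

lemma carrier_poly_ring_mono: "W \<subseteq> V \<Longrightarrow> p \<in> carrier (poly_ring W) \<Longrightarrow> p \<in> carrier (poly_ring V)"
  by (auto simp: carrier_poly_ring)

lemma poly_ring_closed [intro, simp]:
  fixes p q :: "('v, 'k::comm_ring_1) mpoly"
  shows "(0 :: ('v, 'k) mpoly) \<in> carrier (poly_ring V)"
    and "(1 :: ('v, 'k) mpoly) \<in> carrier (poly_ring V)"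
    and "p \<in> carrier (poly_ring V) \<Longrightarrow> - p \<in> carrier (poly_ring V)"
    and "p \<in> carrier (poly_ring V) \<Longrightarrow> q \<in> carrier (poly_ring V) \<Longrightarrow> p + q \<in> carrier (poly_ring V)"
    and "p \<in> carrier (poly_ring V) \<Longrightarrow> q \<in> carrier (poly_ring V) \<Longrightarrow> p * q \<in> carrier (poly_ring V)"
    and "p \<in> carrier (poly_ring V) \<Longrightarrow> q \<in> carrier (poly_ring V) \<Longrightarrow> p - q \<in> carrier (poly_ring V)"
proof -
  interpret cring "poly_ring V :: ('v, 'k) mpoly ring"
    by (rule cring_poly_ring)
  show "(0 :: ('v, 'k) mpoly) \<in> carrier (poly_ring V)" "(1 :: ('v, 'k) mpoly) \<in> carrier (poly_ring V)"
    using zero_closed one_closed by simp_all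
  show *: "- p \<in> carrier (poly_ring V)" if "p \<in> carrier (poly_ring V)" for p :: "('v, 'k) mpoly"
    using that by (simp add: carrier_poly_ring)
  show **: "p + q \<in> carrier (poly_ring V)" if "p \<in> carrier (poly_ring V)" "q \<in> carrier (poly_ring V)"
    for p q :: "('v, 'k) mpoly"
    using a_closed[OF that] by simp
  show "p * q \<in> carrier (poly_ring V)" if "p \<in> carrier (poly_ring V)" "q \<in> carrier (poly_ring V)"
    using m_closed[OF that] by simp
  show "p - q \<in> carrier (poly_ring V)" if "p \<in> carrier (poly_ring V)" "q \<in> carrier (poly_ring V)"
    using **[OF that(1) *[OF that(2)]] by simp
qed

lemma poly_ring_sum_closed [intro]:
  "(\<And>i. i \<in> I \<Longrightarrow> f i \<in> carrier (poly_ring V)) \<Longrightarrow> sum f I \<in> carrier (poly_ring V)"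
  by (induction I rule: infinite_finite_induct) auto

lemma poly_ring_power_closed [intro]:
  "p \<in> carrier (poly_ring V) \<Longrightarrow> p ^ k \<in> carrier (poly_ring V)"
  by (induction k) auto

lemma single_in_poly_ring [intro]:
  "Poly_Mapping.keys m \<subseteq> V \<Longrightarrow> Poly_Mapping.single m c \<in> carrier (poly_ring V)"
  by (simp add: carrier_poly_ring)

text \<open>Stated with the type's own \<open>+\<close> and \<open>*\<close>, so that later
  arguments use ordinary arithmetic. Closure under negation comes from multiplication by
  \<open>- 1\<close>.\<close>

lemma ideal_poly_ring_iff:
  fixes I :: "('v, 'k::comm_ring_1) mpoly set"
  shows "ideal I (poly_ring V) \<longleftrightarrow> I \<subseteq> carrier (poly_ring V) \<and> 0 \<in> I \<and>
    (\<forall>x\<in>I. \<forall>y\<in>I. x + y \<in> I) \<and> (\<forall>c\<in>carrier (poly_ring V). \<forall>x\<in>I. c * x \<in> I)" (is "?L \<longleftrightarrow> ?R")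
proof
  assume ?L
  then interpret ideal I "poly_ring V" .
  show ?R
    using a_subset additive_subgroup.a_closed[OF additive_subgroup_axioms]
      additive_subgroup.zero_closed[OF additive_subgroup_axioms] I_l_closed by auto
next
  assume R: ?R
  interpret cring "poly_ring V :: ('v, 'k) mpoly ring"
    by (rule cring_poly_ring)
  have uminus: "\<ominus>\<^bsub>poly_ring V\<^esub> x = (-1) * x" if "x \<in> I" for x :: "('v, 'k) mpoly"
    by (rule minus_equality) (use that R in auto)
  have right: "x * c \<in> I" if "x \<in> I" "c \<in> carrier (poly_ring V)" for x c
    using R that by (metis mult.commute)
  show ?L
  proof (rule idealI)
    show "subgroup I (add_monoid (poly_ring V))"
    proof (rule group.subgroupI[OF a_group])
      fix a assume "a \<in> I"
      moreover have "(-1) * a \<in> I"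
        using R \<open>a \<in> I\<close> poly_ring_closed(3)[OF poly_ring_closed(2)] by blast
      ultimately show "inv\<^bsub>add_monoid (poly_ring V)\<^esub> a \<in> I"
        by (metis uminus a_inv_def)
    qed (use R in auto)
  qed (use R right in \<open>auto intro: ring_axioms\<close>)
qed

lemma
  fixes I :: "('v, 'k::comm_ring_1) mpoly set"
  assumes "ideal I (poly_ring V)"
  shows ideal_poly_ring_subset: "I \<subseteq> carrier (poly_ring V)"
    and ideal_poly_ring_zero: "0 \<in> I"
    and ideal_poly_ring_add: "x \<in> I \<Longrightarrow> y \<in> I \<Longrightarrow> x + y \<in> I"
    and ideal_poly_ring_mult: "c \<in> carrier (poly_ring V) \<Longrightarrow> x \<in> I \<Longrightarrow> c * x \<in> I"
  using assms by (simp_all add: ideal_poly_ring_iff)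

lemma ideal_poly_ring_diff:
  fixes I :: "('v, 'k::comm_ring_1) mpoly set"
  assumes "ideal I (poly_ring V)" "x \<in> I" "y \<in> I"
  shows "x - y \<in> I"
  using ideal_poly_ring_add[OF assms(1,2) ideal_poly_ring_mult[OF assms(1) _ assms(3), of "- 1"]]
  by simp

lemma ideal_poly_ring_sum:
  fixes f :: "'i \<Rightarrow> ('v, 'k::comm_ring_1) mpoly"
  assumes "ideal I (poly_ring V)" "\<And>i. i \<in> A \<Longrightarrow> f i \<in> I"
  shows "sum f A \<in> I"
  using assms(2)
  by (induction A rule: infinite_finite_induct)
    (auto intro: ideal_poly_ring_zero[OF assms(1)] ideal_poly_ring_add[OF assms(1)])

lemma primeideal_poly_ring_iff:
  fixes P :: "('v, 'k::comm_ring_1) mpoly set"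
  shows "primeideal P (poly_ring V) \<longleftrightarrow> ideal P (poly_ring V) \<and> 1 \<notin> P \<and>
    (\<forall>a\<in>carrier (poly_ring V). \<forall>b\<in>carrier (poly_ring V). a * b \<in> P \<longrightarrow> a \<in> P \<or> b \<in> P)"
    (is "?L \<longleftrightarrow> ?R")
proof
  assume ?L
  then interpret primeideal P "poly_ring V" .
  have "1 \<notin> P"
    using one_imp_carrier I_notcarr by auto
  then show ?R
    using is_ideal I_prime by auto
next
  assume R: ?R
  show ?L
    by (rule primeidealI[OF _ cring_poly_ring]) (use R in auto)
qed

lemma genideal_poly_ring:
  fixes A :: "('v, 'k::comm_ring_1) mpoly set"
  assumes "A \<subseteq> carrier (poly_ring V)"
  shows "ideal (Idl\<^bsub>poly_ring V\<^esub> A) (poly_ring V)" "A \<subseteq> Idl\<^bsub>poly_ring V\<^esub> A"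
    and "\<And>I. ideal I (poly_ring V) \<Longrightarrow> A \<subseteq> I \<Longrightarrow> Idl\<^bsub>poly_ring V\<^esub> A \<subseteq> I"
proof -
  interpret cring "poly_ring V :: ('v, 'k) mpoly ring"
    by (rule cring_poly_ring)
  show "ideal (Idl\<^bsub>poly_ring V\<^esub> A) (poly_ring V)" "A \<subseteq> Idl\<^bsub>poly_ring V\<^esub> A"
    "\<And>I. ideal I (poly_ring V) \<Longrightarrow> A \<subseteq> I \<Longrightarrow> Idl\<^bsub>poly_ring V\<^esub> A \<subseteq> I"
    using assms genideal_ideal genideal_self genideal_minimal by auto
qed

section \<open>Polynomials as sums of their terms\<close>

lemma poly_mapping_sum_single:
  "(\<Sum>m\<in>Poly_Mapping.keys f. Poly_Mapping.single m (Poly_Mapping.lookup f m)) = f"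
  by (rule poly_mapping_eqI)
    (simp add: lookup_sum lookup_single when_def in_keys_iff)

lemma mult_sum_single:
  fixes f g :: "'m::monoid_add \<Rightarrow>\<^sub>0 'r::semiring_0"
  shows "f * g = (\<Sum>a\<in>Poly_Mapping.keys f. \<Sum>b\<in>Poly_Mapping.keys g.
    Poly_Mapping.single (a + b) (Poly_Mapping.lookup f a * Poly_Mapping.lookup g b))"
proof -
  have "f * g = (\<Sum>a\<in>Poly_Mapping.keys f. Poly_Mapping.single a (Poly_Mapping.lookup f a)) *
      (\<Sum>b\<in>Poly_Mapping.keys g. Poly_Mapping.single b (Poly_Mapping.lookup g b))"
    by (simp only: poly_mapping_sum_single)
  then show ?thesis
    by (simp only: sum_product mult_single)
qed

lemma lookup_mult_keys:
  fixes f g :: "'m::monoid_add \<Rightarrow>\<^sub>0 'r::semiring_0"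
  shows "Poly_Mapping.lookup (f * g) k = (\<Sum>a\<in>Poly_Mapping.keys f. \<Sum>b\<in>Poly_Mapping.keys g.
    (Poly_Mapping.lookup f a * Poly_Mapping.lookup g b when a + b = k))"
  by (subst mult_sum_single) (simp add: lookup_sum lookup_single)

section \<open>Extensions of contracted primes\<close>

text \<open>The universal property of the monoid algebra: \<open>t m c\<close> is the image of \<open>c m\<close>.\<close>

definition lift :: "('m \<Rightarrow> 'k \<Rightarrow> 'r) \<Rightarrow> ('m \<Rightarrow>\<^sub>0 'k::zero) \<Rightarrow> 'r::comm_ring_1" where
  "lift t f = (\<Sum>m\<in>Poly_Mapping.keys f. t m (Poly_Mapping.lookup f m))"

text \<open>Monomial and coefficient are mapped jointly: \<open>t\<close> is additive in the
  coefficient and multiplicative in the pair, which is what makes \<open>lift t\<close> a ring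
  homomorphism.\<close>

locale monoid_algebra_hom =
  fixes t :: "'m::comm_monoid_add \<Rightarrow> 'k::comm_ring_1 \<Rightarrow> 'r::comm_ring_1"
  assumes t_add: "t m (c + d) = t m c + t m d"
    and t_mult: "t (m + m') (c * d) = t m c * t m' d"
    and t_one: "t 0 1 = 1"
begin

lemma t_zero [simp]: "t m 0 = 0"
  using t_add[of m 0 0] by simp

lemma lift_zero [simp]: "lift t 0 = 0"
  by (simp add: lift_def)

lemma lift_add: "lift t (f + g) = lift t f + lift t g"
  unfolding lift_def by (rule setsum_keys_plus_distrib) (simp_all add: t_add)

lemma lift_single [simp]: "lift t (Poly_Mapping.single m c) = t m c"
  by (cases "c = 0") (simp_all add: lift_def)

lemma lift_one [simp]: "lift t 1 = 1"
  using lift_single[of 0 1] by (simp add: t_one)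

lemma lift_sum: "lift t (sum f A) = (\<Sum>i\<in>A. lift t (f i))"
  by (induction A rule: infinite_finite_induct) (simp_all add: lift_add)

lemma lift_mult: "lift t (f * g) = lift t f * lift t g"
  by (subst mult_sum_single) (simp add: lift_sum t_mult, simp add: lift_def sum_product)

lemma lift_diff: "lift t (f - g) = lift t f - lift t g"
  using lift_add[of "f - g" g] by simp

end

section \<open>Separating the variables inside and outside a set\<close>

definition restr :: "'v set \<Rightarrow> ('v \<Rightarrow>\<^sub>0 nat) \<Rightarrow> ('v \<Rightarrow>\<^sub>0 nat)" where
  "restr W m = Poly_Mapping.mapp (\<lambda>v c. c when v \<in> W) m"

lemma lookup_restr: "Poly_Mapping.lookup (restr W m) v = (Poly_Mapping.lookup m v when v \<in> W)"
  by (simp add: restr_def lookup_mapp when_def in_keys_iff)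

lemma restr_zero [simp]: "restr W 0 = 0"
  by (rule poly_mapping_eqI) (simp add: lookup_restr)

lemma restr_add: "restr W (m + m') = restr W m + restr W m'"
  by (rule poly_mapping_eqI) (simp add: lookup_restr lookup_add when_add_distrib)

lemma restr_add_restr_Compl: "restr W m + restr (- W) m = m"
  by (rule poly_mapping_eqI) (simp add: lookup_restr lookup_add when_def)

lemma keys_restr: "Poly_Mapping.keys (restr W m) = Poly_Mapping.keys m \<inter> W"
  by (auto simp: in_keys_iff lookup_restr when_def split: if_splits)

lemma restr_eq_self: "Poly_Mapping.keys m \<subseteq> W \<Longrightarrow> restr W m = m"
  by (rule poly_mapping_eqI) (auto simp: lookup_restr when_def in_keys_iff)

lemma restr_eq_zero: "Poly_Mapping.keys m \<inter> W = {} \<Longrightarrow> restr W m = 0"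
  by (rule poly_mapping_eqI) (auto simp: lookup_restr when_def in_keys_iff)

text \<open>\<open>split_vars W\<close> views a polynomial as one in the variables outside \<open>W\<close> with coefficients in
  \<open>'k[W]\<close>, and \<open>join_vars\<close> multiplies out.\<close>

definition split_vars :: "'v set \<Rightarrow> ('v, 'k::comm_ring_1) mpoly \<Rightarrow> ('v, ('v, 'k) mpoly) mpoly" where
  "split_vars W =
     lift (\<lambda>m c. Poly_Mapping.single (restr (- W) m) (Poly_Mapping.single (restr W m) c))"

definition join_vars :: "('v, ('v, 'k::comm_ring_1) mpoly) mpoly \<Rightarrow> ('v, 'k) mpoly" where
  "join_vars = lift (\<lambda>m c. c * Poly_Mapping.single m 1)"

interpretation split_vars: monoid_algebra_hom
  "\<lambda>m c. Poly_Mapping.single (restr (- W) m) (Poly_Mapping.single (restr W m) c)" for W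
  by standard (simp_all add: single_add restr_add mult_single)

interpretation join_vars: monoid_algebra_hom
  "\<lambda>(m :: 'v \<Rightarrow>\<^sub>0 nat) (c :: ('v, 'k::comm_ring_1) mpoly). c * Poly_Mapping.single m 1"
proof
  fix m m' :: "'v \<Rightarrow>\<^sub>0 nat" and c d :: "('v, 'k) mpoly"
  have "c * d * Poly_Mapping.single (m + m') 1
      = c * d * (Poly_Mapping.single m 1 * Poly_Mapping.single m' 1)"
    by (simp add: mult_single)
  then show "c * d * Poly_Mapping.single (m + m') 1
      = c * Poly_Mapping.single m 1 * (d * Poly_Mapping.single m' 1)"
    by (simp add: ac_simps)
qed (simp_all add: algebra_simps)

lemma split_vars_mult: "split_vars W (f * g) = split_vars W f * split_vars W g"
  by (simp add: split_vars_def split_vars.lift_mult)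

lemma split_vars_diff: "split_vars W (f - g) = split_vars W f - split_vars W g"
  by (simp add: split_vars_def split_vars.lift_diff)

text \<open>Each monomial is the product of its parts inside and outside \<open>W\<close>, so
  multiplying out undoes the grouping.\<close>

lemma join_split_vars: "join_vars (split_vars W f) = f"
proof -
  have "split_vars W f = (\<Sum>m\<in>Poly_Mapping.keys f.
      Poly_Mapping.single (restr (- W) m) (Poly_Mapping.single (restr W m) (Poly_Mapping.lookup f m)))"
    by (simp only: split_vars_def lift_def)
  then show ?thesis
    by (simp add: join_vars_def join_vars.lift_sum mult_single restr_add_restr_Compl
        poly_mapping_sum_single)
qed

lemma lookup_split_vars: "Poly_Mapping.lookup (split_vars W f) \<mu> =
  (\<Sum>m\<in>Poly_Mapping.keys f.
    Poly_Mapping.single (restr W m) (Poly_Mapping.lookup f m) when restr (- W) m = \<mu>)"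
  by (simp add: split_vars_def lift_def lookup_sum lookup_single)

lemma split_vars_coeff_closed:
  assumes "f \<in> carrier (poly_ring V)"
  shows "Poly_Mapping.lookup (split_vars W f) \<mu> \<in> carrier (poly_ring (V \<inter> W))"
  unfolding lookup_split_vars when_def using assms
  by (intro poly_ring_sum_closed) (auto simp: keys_restr carrier_poly_ring)

lemma keys_split_vars:
  assumes "f \<in> carrier (poly_ring V)" "\<mu> \<in> Poly_Mapping.keys (split_vars W f)"
  shows "Poly_Mapping.keys \<mu> \<subseteq> V - W"
proof -
  have "(\<Sum>m\<in>Poly_Mapping.keys f.
      Poly_Mapping.single (restr W m) (Poly_Mapping.lookup f m) when restr (- W) m = \<mu>) \<noteq> 0"
    using assms(2) by (simp add: in_keys_iff lookup_split_vars)
  then obtain m where m: "m \<in> Poly_Mapping.keys f" "restr (- W) m = \<mu>"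
    by (rule sum.not_neutral_contains_not_neutral) (auto simp: when_def split: if_splits)
  then have "Poly_Mapping.keys m \<subseteq> V"
    using assms(1) by (simp add: carrier_poly_ring)
  then show ?thesis
    using m(2) by (auto simp: keys_restr)
qed

lemma split_vars_coeff_ring:
  assumes "f \<in> carrier (poly_ring W)"
  shows "split_vars W f = Poly_Mapping.single 0 f"
proof -
  have "split_vars W f = (\<Sum>m\<in>Poly_Mapping.keys f.
      Poly_Mapping.single 0 (Poly_Mapping.single m (Poly_Mapping.lookup f m)))"
    unfolding split_vars_def lift_def
  proof (rule sum.cong[OF refl])
    fix m assume "m \<in> Poly_Mapping.keys f"
    then have "Poly_Mapping.keys m \<subseteq> W"
      using assms by (simp add: carrier_poly_ring)
    then have "restr W m = m" "restr (- W) m = 0"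
      by (auto intro: restr_eq_self restr_eq_zero)
    then show "Poly_Mapping.single (restr (- W) m)
        (Poly_Mapping.single (restr W m) (Poly_Mapping.lookup f m)) =
      Poly_Mapping.single 0 (Poly_Mapping.single m (Poly_Mapping.lookup f m))"
      by simp
  qed
  also have "\<dots> = Poly_Mapping.single 0 (\<Sum>m\<in>Poly_Mapping.keys f.
      Poly_Mapping.single m (Poly_Mapping.lookup f m))"
    by (rule poly_mapping_eqI) (simp add: lookup_sum lookup_single when_def)
  finally show ?thesis
    by (simp add: poly_mapping_sum_single)
qed

lemma split_vars_indet:
  assumes "v \<notin> W"
  shows "split_vars W (indet v) = indet v"
  using assms unfolding indet_def split_vars_def
  by (simp add: restr_eq_self restr_eq_zero)

text \<open>A leading coefficient argument, as for Gauss's lemma.\<close>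

lemma prime_ideal_coefficients:
  fixes F H :: "('m::{ordered_cancel_comm_monoid_add, linorder}) \<Rightarrow>\<^sub>0 ('v, 'k::comm_ring_1) mpoly"
  assumes P: "primeideal P (poly_ring V)"
    and F: "\<And>m. Poly_Mapping.lookup F m \<in> carrier (poly_ring V)"
    and H: "\<And>m. Poly_Mapping.lookup H m \<in> carrier (poly_ring V)"
    and FH: "\<And>m. Poly_Mapping.lookup (F * H) m \<in> P"
  shows "(\<forall>m. Poly_Mapping.lookup F m \<in> P) \<or> (\<forall>m. Poly_Mapping.lookup H m \<in> P)"
proof (rule ccontr)
  have ideal: "ideal P (poly_ring V)"
    and prime: "\<And>a b. a \<in> carrier (poly_ring V) \<Longrightarrow> b \<in> carrier (poly_ring V) \<Longrightarrow> a * b \<in> P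
      \<Longrightarrow> a \<in> P \<or> b \<in> P"
    using P by (auto simp: primeideal_poly_ring_iff)
  assume contr: "\<not> ?thesis"
  let ?A = "{m\<in>Poly_Mapping.keys F. Poly_Mapping.lookup F m \<notin> P}"
  let ?B = "{m\<in>Poly_Mapping.keys H. Poly_Mapping.lookup H m \<notin> P}"
  have in_P: "Poly_Mapping.lookup G m \<in> P" if "m \<notin> Poly_Mapping.keys G"
    for m :: 'm and G :: "'m \<Rightarrow>\<^sub>0 ('v, 'k) mpoly"
    using that ideal_poly_ring_zero[OF ideal] by (simp add: in_keys_iff)
  have "?A \<noteq> {}" "?B \<noteq> {}"
    using contr in_P[of _ F] in_P[of _ H] by auto
  \<comment> \<open>The leading terms are taken among the coefficients outside \<open>P\<close>, not
    among all nonzero ones.\<close>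
  define a b where "a = Max ?A" and "b = Max ?B"
  have a: "a \<in> ?A" and b: "b \<in> ?B"
    unfolding a_def b_def using \<open>?A \<noteq> {}\<close> \<open>?B \<noteq> {}\<close> by (intro Max_in; simp)+
  have a_max: "Poly_Mapping.lookup F m \<in> P" if "a < m" for m
  proof (rule ccontr)
    assume "Poly_Mapping.lookup F m \<notin> P"
    then have "m \<in> ?A"
      using in_P[of m F] by auto
    then have "m \<le> a"
      unfolding a_def by (intro Max_ge) auto
    then show False
      using that by simp
  qed
  have b_max: "Poly_Mapping.lookup H m \<in> P" if "b < m" for m
  proof (rule ccontr)
    assume "Poly_Mapping.lookup H m \<notin> P"
    then have "m \<in> ?B"
      using in_P[of m H] by auto
    then have "m \<le> b"
      unfolding b_def by (intro Max_ge) auto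
    then show False
      using that by simp
  qed
  let ?t = "\<lambda>(i, j). (Poly_Mapping.lookup F i * Poly_Mapping.lookup H j when i + j = a + b)"
  let ?K = "Poly_Mapping.keys F \<times> Poly_Mapping.keys H"
  have "(\<Sum>p\<in>?K. ?t p) \<in> P"
    using FH[of "a + b"] by (simp add: lookup_mult_keys sum.cartesian_product)
  moreover have "(\<Sum>p\<in>?K. ?t p) = ?t (a, b) + (\<Sum>p\<in>?K - {(a, b)}. ?t p)"
    using a b by (intro sum.remove) auto
  moreover have "(\<Sum>p\<in>?K - {(a, b)}. ?t p) \<in> P"
  proof (rule ideal_poly_ring_sum[OF ideal])
    fix p assume p: "p \<in> ?K - {(a, b)}"
    obtain i j where ij: "p = (i, j)"
      by (cases p)
    \<comment> \<open>By monotonicity of addition, a pair other than \<open>(a, b)\<close> with the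
      same sum exceeds \<open>a\<close> or \<open>b\<close> in one component, where the coefficient
      lies in \<open>P\<close>.\<close>
    consider "i + j \<noteq> a + b" | "i + j = a + b" "a < i" | "i + j = a + b" "b < j"
    proof (cases "i + j = a + b")
      case True
      have "\<not> (i \<le> a \<and> j \<le> b)"
      proof
        assume le: "i \<le> a \<and> j \<le> b"
        have "i = a"
        proof (rule ccontr)
          assume "i \<noteq> a"
          then have "i + j < a + b"
            using le by (intro add_less_le_mono) auto
          then show False
            using True by simp
        qed
        then show False
          using True p ij by simp
      qed
      then show ?thesis
        using True that by auto
    qed (use that in auto)
    then show "?t p \<in> P"
    proof cases
      case 1
      then show ?thesis
        using ideal_poly_ring_zero[OF ideal] by (simp add: ij)
    next
      case 2
      then show ?thesis
        using ideal_poly_ring_mult[OF ideal H a_max, of i j] by (simp add: ij mult.commute)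
    next
      case 3
      then show ?thesis
        using ideal_poly_ring_mult[OF ideal F b_max, of j i] by (simp add: ij)
    qed
  qed
  ultimately have "?t (a, b) \<in> P"
    using ideal_poly_ring_diff[OF ideal, of "\<Sum>p\<in>?K. ?t p" "\<Sum>p\<in>?K - {(a, b)}. ?t p"] by simp
  then show False
    using a b prime[OF F H, of a b] by auto
qed

text \<open>The contraction to \<open>k[W]\<close> is extended back to \<open>k[V]\<close>, so that
  growing \<open>W\<close> yields an increasing family of ideals in one ring.\<close>

definition ext_contr :: "'v set \<Rightarrow> ('v, 'k::comm_ring_1) mpoly set \<Rightarrow> 'v set \<Rightarrow> ('v, 'k) mpoly set" where
  "ext_contr V P W = Idl\<^bsub>poly_ring V\<^esub> (P \<inter> carrier (poly_ring W))"

context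
  fixes V W :: "'v::linorder set" and P :: "('v, 'k::comm_ring_1) mpoly set"
  assumes ideal: "ideal P (poly_ring V)" and WV: "W \<subseteq> V"
begin

text \<open>A coefficient of a product is a sum of products of coefficients, and \<open>P\<close>
  absorbs multiples. This prepares the description of \<open>ext_contr\<close> by
  coefficients.\<close>

lemma ideal_split_vars:
  "ideal {f \<in> carrier (poly_ring V). \<forall>\<mu>. Poly_Mapping.lookup (split_vars W f) \<mu> \<in> P} (poly_ring V)"
    (is "ideal ?J _")
  unfolding ideal_poly_ring_iff
proof (intro conjI ballI)
  have "split_vars W (0 :: ('v, 'k) mpoly) = 0"
    by (simp add: split_vars_def)
  then show "0 \<in> ?J"
    by (simp add: ideal_poly_ring_zero[OF ideal])
  show "x + y \<in> ?J" if "x \<in> ?J" "y \<in> ?J" for x y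
    using that
    by (simp add: split_vars_def split_vars.lift_add lookup_add ideal_poly_ring_add[OF ideal])
  show "c * x \<in> ?J" if c: "c \<in> carrier (poly_ring V)" and x: "x \<in> ?J" for c x
  proof -
    have "Poly_Mapping.lookup (split_vars W c * split_vars W x) \<mu> \<in> P" for \<mu>
      unfolding lookup_mult_keys
    proof (intro ideal_poly_ring_sum[OF ideal])
      fix i j
      have "Poly_Mapping.lookup (split_vars W c) i * Poly_Mapping.lookup (split_vars W x) j \<in> P"
        by (rule ideal_poly_ring_mult[OF ideal])
          (use x split_vars_coeff_closed[OF c] in \<open>auto intro: carrier_poly_ring_mono[of "V \<inter> W" V]\<close>)
      then show "(Poly_Mapping.lookup (split_vars W c) i * Poly_Mapping.lookup (split_vars W x) j
          when i + j = \<mu>) \<in> P"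
        using ideal_poly_ring_zero[OF ideal] by (simp add: when_def)
    qed
    then show ?thesis
      using c x by (simp add: split_vars_mult)
  qed
qed auto

text \<open>The ideal given by the coefficient condition contains the generators, which are constant
  over \<open>k[W]\<close>; conversely \<open>f\<close> is the sum of its coefficients, elements of
  \<open>P\<close> in \<open>k[W]\<close>, times monomials in the other variables.\<close>

lemma ext_contr_iff:
  "f \<in> ext_contr V P W \<longleftrightarrow>
    f \<in> carrier (poly_ring V) \<and> (\<forall>\<mu>. Poly_Mapping.lookup (split_vars W f) \<mu> \<in> P)"
proof -
  let ?J = "{f \<in> carrier (poly_ring V). \<forall>\<mu>. Poly_Mapping.lookup (split_vars W f) \<mu> \<in> P}"
  have sub: "P \<inter> carrier (poly_ring W) \<subseteq> carrier (poly_ring V)"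
    using carrier_poly_ring_mono[OF WV] by auto
  have "ext_contr V P W \<subseteq> ?J"
    unfolding ext_contr_def
  proof (rule genideal_poly_ring(3)[OF sub ideal_split_vars], rule subsetI)
    fix f assume f: "f \<in> P \<inter> carrier (poly_ring W)"
    then have "split_vars W f = Poly_Mapping.single 0 f"
      by (intro split_vars_coeff_ring) auto
    then show "f \<in> ?J"
      using f sub ideal_poly_ring_zero[OF ideal] by (auto simp: lookup_single when_def)
  qed
  moreover have "f \<in> ext_contr V P W" if f: "f \<in> ?J" for f
  proof -
    have "f = (\<Sum>\<mu>\<in>Poly_Mapping.keys (split_vars W f).
        Poly_Mapping.single \<mu> 1 * Poly_Mapping.lookup (split_vars W f) \<mu>)"
      by (subst join_split_vars[symmetric, of _ W]) (simp add: join_vars_def lift_def mult.commute)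
    also have "\<dots> \<in> ext_contr V P W"
      unfolding ext_contr_def
    proof (intro ideal_poly_ring_sum[OF genideal_poly_ring(1)[OF sub]]
        ideal_poly_ring_mult[OF genideal_poly_ring(1)[OF sub]])
      fix \<mu> assume \<mu>: "\<mu> \<in> Poly_Mapping.keys (split_vars W f)"
      show "Poly_Mapping.single \<mu> 1 \<in> carrier (poly_ring V)"
        using keys_split_vars[of f V \<mu> W] f \<mu> by (intro single_in_poly_ring) auto
      show "Poly_Mapping.lookup (split_vars W f) \<mu> \<in> Idl\<^bsub>poly_ring V\<^esub> (P \<inter> carrier (poly_ring W))"
        using f split_vars_coeff_closed[of f V W \<mu>]
        by (intro subsetD[OF genideal_poly_ring(2)[OF sub]])
          (auto intro: carrier_poly_ring_mono[of "V \<inter> W" W])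
    qed
    finally show ?thesis .
  qed
  ultimately show ?thesis
    by blast
qed

end

text \<open>As for the extension of a prime from a coefficient ring to a polynomial ring: after
  splitting the variables, \<open>prime_ideal_coefficients\<close> applies. The linear order on the
  variables provides the order on monomials used there.\<close>

lemma ext_contr_prime:
  fixes V :: "'v::linorder set" and P :: "('v, 'k::comm_ring_1) mpoly set"
  assumes P: "primeideal P (poly_ring V)" and WV: "W \<subseteq> V"
  shows "primeideal (ext_contr V P W) (poly_ring V)"
proof -
  have ideal: "ideal P (poly_ring V)" and one: "1 \<notin> P"
    using P by (auto simp: primeideal_poly_ring_iff)
  note iff = ext_contr_iff[OF ideal WV]
  have coeff: "Poly_Mapping.lookup (split_vars W f) \<mu> \<in> carrier (poly_ring V)"
    if "f \<in> carrier (poly_ring V)" for f :: "('v, 'k) mpoly" and \<mu>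
    using split_vars_coeff_closed[OF that] by (rule carrier_poly_ring_mono[rotated]) auto
  have "ideal (ext_contr V P W) (poly_ring V)"
  proof -
    have "ext_contr V P W =
        {f \<in> carrier (poly_ring V). \<forall>\<mu>. Poly_Mapping.lookup (split_vars W f) \<mu> \<in> P}"
      using iff by blast
    then show ?thesis
      using ideal_split_vars[OF ideal WV] by simp
  qed
  moreover have "1 \<notin> ext_contr V P W"
  proof -
    have "split_vars W (1 :: ('v, 'k) mpoly) = 1"
      by (simp add: split_vars_def)
    then show ?thesis
      using one unfolding iff by (auto simp: lookup_one intro!: exI[of _ 0])
  qed
  moreover have "a \<in> ext_contr V P W \<or> b \<in> ext_contr V P W"
    if ab: "a \<in> carrier (poly_ring V)" "b \<in> carrier (poly_ring V)" "a * b \<in> ext_contr V P W" for a b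
  proof -
    have "(\<forall>m. Poly_Mapping.lookup (split_vars W a) m \<in> P) \<or>
        (\<forall>m. Poly_Mapping.lookup (split_vars W b) m \<in> P)"
      using ab by (intro prime_ideal_coefficients[OF P] coeff) (simp_all add: iff flip: split_vars_mult)
    then show ?thesis
      using ab by (auto simp: iff)
  qed
  ultimately show ?thesis
    by (simp add: primeideal_poly_ring_iff)
qed

lemma ext_contr_mono:
  fixes V :: "'v::linorder set" and P :: "('v, 'k::comm_ring_1) mpoly set"
  assumes "W \<subseteq> W'" "W' \<subseteq> V"
  shows "ext_contr V P W \<subseteq> ext_contr V P W'"
proof -
  have sub: "P \<inter> carrier (poly_ring U) \<subseteq> carrier (poly_ring V)" if "U \<subseteq> V" for U
    using carrier_poly_ring_mono[OF that] by auto
  have "P \<inter> carrier (poly_ring W) \<subseteq> P \<inter> carrier (poly_ring W')"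
    using carrier_poly_ring_mono[OF assms(1)] by auto
  also have "\<dots> \<subseteq> ext_contr V P W'"
    unfolding ext_contr_def by (rule genideal_poly_ring(2)[OF sub[OF assms(2)]])
  finally show ?thesis
    unfolding ext_contr_def[of V P W] using assms
    by (intro genideal_poly_ring(3)[OF sub]) (auto simp: ext_contr_def intro!: genideal_poly_ring(1) sub)
qed

lemma ext_contr_all:
  fixes V :: "'v::linorder set" and P :: "('v, 'k::comm_ring_1) mpoly set"
  assumes "ideal P (poly_ring V)"
  shows "ext_contr V P V = P"
proof -
  have P: "P \<inter> carrier (poly_ring V) = P"
    using ideal_poly_ring_subset[OF assms] by auto
  show ?thesis
    unfolding ext_contr_def P
    by (intro antisym genideal_poly_ring(2,3) ideal_poly_ring_subset[OF assms] assms) auto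
qed

lemma in_ext_contrI:
  fixes V :: "'v::linorder set" and P :: "('v, 'k::comm_ring_1) mpoly set"
  assumes "f \<in> P" "f \<in> carrier (poly_ring W)" "W \<subseteq> V"
  shows "f \<in> ext_contr V P W"
proof -
  have "P \<inter> carrier (poly_ring W) \<subseteq> carrier (poly_ring V)"
    using carrier_poly_ring_mono[OF assms(3)] by auto
  from genideal_poly_ring(2)[OF this] show ?thesis
    using assms unfolding ext_contr_def by auto
qed

text \<open>Over \<open>k[W]\<close> the variable \<open>v\<close> has the coefficient 1, which no
  prime contains.\<close>

lemma indet_notin_ext_contr:
  fixes V :: "'v::linorder set" and P :: "('v, 'k::comm_ring_1) mpoly set"
  assumes P: "primeideal P (poly_ring V)" and WV: "W \<subseteq> V" and v: "v \<notin> W"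
  shows "indet v \<notin> ext_contr V P W"
proof
  have ideal: "ideal P (poly_ring V)" and one: "1 \<notin> P"
    using P by (auto simp: primeideal_poly_ring_iff)
  assume "indet v \<in> ext_contr V P W"
  then have "Poly_Mapping.lookup (indet v) (Poly_Mapping.single v 1) \<in> P"
    using ext_contr_iff[OF ideal WV] split_vars_indet[OF v] by metis
  then show False
    using one by (simp add: indet_def)
qed

section \<open>Growth of height along strict inclusions\<close>

lemma prime_height_strict:
  assumes "P \<in> Spec R" "Q \<in> Spec R" "P \<subset> Q"
  shows "prime_height R P + 1 \<le> prime_height R Q"
proof -
  let ?L = "\<lambda>P. {enat k | k C. (\<forall>i\<le>k. C i \<in> Spec R) \<and> (\<forall>i<k. C i \<subset> C (Suc i)) \<and> C k = P}"
  have "enat 0 \<in> ?L P"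
    using assms(1) by (auto intro!: exI[of _ "\<lambda>_. P"])
  then have ne: "?L P \<noteq> {}"
    by blast
  have step: "x + 1 \<le> Sup (?L Q)" if x: "x \<in> ?L P" for x
  proof -
    obtain k C where x: "x = enat k" and
      C: "\<forall>i\<le>k. C i \<in> Spec R" "\<forall>i<k. C i \<subset> C (Suc i)" "C k = P"
      using x by blast
    let ?D = "C(Suc k := Q)"
    have "\<forall>i\<le>Suc k. ?D i \<in> Spec R" "\<forall>i<Suc k. ?D i \<subset> ?D (Suc i)" "?D (Suc k) = Q"
      using C assms by (auto simp: le_Suc_eq less_Suc_eq)
    then have "enat (Suc k) \<in> ?L Q"
      by blast
    then show ?thesis
      unfolding x by (intro Sup_upper2[of "enat (Suc k)"]) (auto simp: one_enat_def)
  qed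
  show ?thesis
    unfolding prime_height_def
  \<comment> \<open>A finite set of lengths attains its supremum, and that chain is prolonged by
    \<open>Q\<close>; otherwise the supremum is \<infinity> and monotonicity suffices.\<close>
  proof (cases "finite (?L P)")
    case True
    then have "Sup (?L P) = Max (?L P)"
      unfolding Sup_enat_def using ne by presburger
    with Max_in[OF True ne] have "Sup (?L P) \<in> ?L P"
      by (simp only:)
    then show "Sup (?L P) + 1 \<le> Sup (?L Q)"
      by (rule step)
  next
    case False
    have "Sup (?L P) \<le> Sup (?L Q)"
      using prime_height_mono[of Q R P] assms by (auto simp: prime_height_def)
    moreover have "Sup (?L P) = \<infinity>"
      unfolding Sup_enat_def using False ne by presburger
    ultimately show "Sup (?L P) + 1 \<le> Sup (?L Q)"
      by simp
  qed
qed

text \<open>The witness \<open>f\<close> makes the inclusion of the two primes strict. Lower bounds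
  on heights come from repeating this step.\<close>

lemma prime_height_ext_contr_step:
  fixes V :: "'v::linorder set" and P :: "('v, 'k::comm_ring_1) mpoly set"
  assumes P: "primeideal P (poly_ring V)" and W: "W \<subseteq> W'" "W' \<subseteq> V"
    and f: "f \<in> P" "f \<in> carrier (poly_ring W')" "f \<notin> ext_contr V P W"
  shows "prime_height (poly_ring V) (ext_contr V P W) + 1
    \<le> prime_height (poly_ring V) (ext_contr V P W')"
proof (rule prime_height_strict)
  show "ext_contr V P W \<in> Spec (poly_ring V)" "ext_contr V P W' \<in> Spec (poly_ring V)"
    using ext_contr_prime[OF P] W by (auto simp: Spec_def)
  show "ext_contr V P W \<subset> ext_contr V P W'"
    using ext_contr_mono[OF W] in_ext_contrI[OF f(1,2) W(2)] f(3) by blast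
qed

section \<open>An upper bound for the height of a prime\<close>

definition monomials :: "'v set \<Rightarrow> nat \<Rightarrow> ('v \<Rightarrow>\<^sub>0 nat) set" where
  "monomials V N = {m. Poly_Mapping.keys m \<subseteq> V \<and> (\<forall>v. Poly_Mapping.lookup m v < N)}"

text \<open>Monomials correspond to functions from \<open>V\<close> to \<open>{..<N}\<close>;
  \<open>0 < N\<close> admits the exponent 0 of the variables outside \<open>V\<close>.\<close>

lemma card_monomials:
  assumes "finite V" "0 < N"
  shows "finite (monomials V N) \<and> card (monomials V N) = N ^ card V"
proof -
  have "bij_betw (\<lambda>m. restrict (Poly_Mapping.lookup m) V) (monomials V N) (V \<rightarrow>\<^sub>E {..<N})"
  proof (rule bij_betw_byWitness)
    let ?g = "\<lambda>h. Abs_poly_mapping (\<lambda>v. if v \<in> V then h v else (0::nat))"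
    have g: "Poly_Mapping.lookup (?g h) v = (if v \<in> V then h v else 0)" for h v
    proof -
      have "finite {v. (if v \<in> V then h v else 0) \<noteq> 0}"
        by (rule finite_subset[OF _ assms(1)]) auto
      then show ?thesis
        by simp
    qed
    show "\<forall>m\<in>monomials V N. ?g (restrict (Poly_Mapping.lookup m) V) = m"
      by (auto simp: monomials_def g in_keys_iff intro!: poly_mapping_eqI)
    show "\<forall>h\<in>V \<rightarrow>\<^sub>E {..<N}. restrict (Poly_Mapping.lookup (?g h)) V = h"
      by (auto simp: g fun_eq_iff PiE_def extensional_def)
    show "(\<lambda>m. restrict (Poly_Mapping.lookup m) V) ` monomials V N \<subseteq> V \<rightarrow>\<^sub>E {..<N}"
      by (auto simp: monomials_def)
    show "?g ` (V \<rightarrow>\<^sub>E {..<N}) \<subseteq> monomials V N"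
      using assms(2) by (auto simp: monomials_def g in_keys_iff PiE_def split: if_splits)
  qed
  then show ?thesis
    using assms card_PiE[of V "\<lambda>_. {..<N}"] finite_PiE[of V "\<lambda>_. {..<N}"]
    by (auto simp: bij_betw_same_card dest: bij_betw_finite)
qed

text \<open>Bounding each exponent separately, not the total degree, makes the dimension over a
  field the plain power \<open>Suc D ^ card V\<close> for finite \<open>V\<close>.\<close>

definition box :: "'v set \<Rightarrow> nat \<Rightarrow> ('v, 'k::comm_ring_1) mpoly set" where
  "box V D = {p \<in> carrier (poly_ring V).
    \<forall>m\<in>Poly_Mapping.keys p. \<forall>v. Poly_Mapping.lookup m v \<le> D}"

lemma box_mono: "D \<le> E \<Longrightarrow> p \<in> box V D \<Longrightarrow> p \<in> box V E"
  unfolding box_def by (blast intro: order_trans)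

lemma box_mult:
  assumes "p \<in> box V D" "q \<in> box V E"
  shows "p * q \<in> box V (D + E)"
proof -
  have "Poly_Mapping.lookup m v \<le> D + E" if m: "m \<in> Poly_Mapping.keys (p * q)" for m v
  proof -
    obtain a b where "a \<in> Poly_Mapping.keys p" "b \<in> Poly_Mapping.keys q" "m = a + b"
      using m keys_mult[of p q] by blast
    then show ?thesis
      using assms by (simp add: box_def lookup_add add_mono)
  qed
  then show ?thesis
    using assms by (simp add: box_def)
qed

lemma box_power:
  assumes "p \<in> box V D"
  shows "p ^ e \<in> box V (e * D)"
proof (induction e)
  case 0
  have "Poly_Mapping.keys (1 :: ('a, 'b) mpoly) \<subseteq> {0}"
    using keys_single[of 0 "1::'b"] by (cases "(1::'b) = 0") simp_all
  then show ?case
    by (auto simp: box_def)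
next
  case (Suc e)
  then show ?case
    using box_mult[OF assms] by simp
qed

lemma box_exists:
  assumes "p \<in> carrier (poly_ring V)"
  obtains D where "p \<in> box V D"
proof
  let ?D = "\<Sum>m\<in>Poly_Mapping.keys p. \<Sum>v\<in>Poly_Mapping.keys m. Poly_Mapping.lookup m v"
  have "Poly_Mapping.lookup m v \<le> ?D" if m: "m \<in> Poly_Mapping.keys p" for m v
  proof (cases "v \<in> Poly_Mapping.keys m")
    case True
    then have "Poly_Mapping.lookup m v \<le> (\<Sum>v\<in>Poly_Mapping.keys m. Poly_Mapping.lookup m v)"
      by (intro member_le_sum) auto
    also have "\<dots> \<le> ?D"
      using m by (intro member_le_sum[of m _ "\<lambda>m. \<Sum>v\<in>Poly_Mapping.keys m. Poly_Mapping.lookup m v"]) auto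
    finally show ?thesis .
  qed (simp add: in_keys_iff)
  then show "p \<in> box V ?D"
    using assms by (simp add: box_def)
qed

section \<open>Linear independence and dimension counts\<close>

interpretation mpoly: vector_space
  "\<lambda>(c :: 'k::field) (p :: ('v, 'k) mpoly). Poly_Mapping.single 0 c * p"
proof
  fix a b :: 'k and p q :: "('v, 'k) mpoly"
  show "Poly_Mapping.single 0 a * (Poly_Mapping.single 0 b * p) = Poly_Mapping.single 0 (a * b) * p"
    by (simp add: mult.assoc[symmetric] mult_single)
qed (simp_all add: algebra_simps single_add)

text \<open>The monomials with exponents below \<open>Suc D\<close> span the box, and an independent
  set is no larger than a finite spanning set.\<close>

lemma card_independent_in_box:
  fixes B :: "('v, 'k::field) mpoly set"
  assumes "finite V" "B \<subseteq> box V D" "mpoly.independent B"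
  shows "card B \<le> Suc D ^ card V"
proof -
  let ?T = "(\<lambda>m. Poly_Mapping.single m (1::'k)) ` monomials V (Suc D)"
  have fin: "finite (monomials V (Suc D))" and card: "card (monomials V (Suc D)) = Suc D ^ card V"
    using card_monomials[OF assms(1), of "Suc D"] by auto
  have "B \<subseteq> mpoly.span ?T"
  proof
    fix p assume "p \<in> B"
    then have p: "p \<in> box V D"
      using assms(2) by auto
    have "p = (\<Sum>m\<in>Poly_Mapping.keys p.
        Poly_Mapping.single 0 (Poly_Mapping.lookup p m) * Poly_Mapping.single m 1)"
      by (simp add: mult_single poly_mapping_sum_single)
    also have "\<dots> \<in> mpoly.span ?T"
      using p by (intro mpoly.span_sum mpoly.span_scale mpoly.span_base imageI)
        (auto simp: box_def monomials_def carrier_poly_ring less_Suc_eq_le)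
    finally show "p \<in> mpoly.span ?T" .
  qed
  then have "card B \<le> card ?T"
    using mpoly.independent_span_bound[OF finite_imageI[OF fin] assms(3)] by simp
  also have "\<dots> \<le> Suc D ^ card V"
    using card_image_le[OF fin] card by simp
  finally show ?thesis .
qed

text \<open>Linear independence over \<open>k\<close> of residue classes modulo \<open>P\<close>,
  without forming the quotient. It concerns an indexed family, so for an ideal \<open>P\<close> a
  repetition counts as a dependence.\<close>

definition indep_mod :: "('v, 'k::field) mpoly set \<Rightarrow> 'i set \<Rightarrow> ('i \<Rightarrow> ('v, 'k) mpoly) \<Rightarrow> bool" where
  "indep_mod P I b \<longleftrightarrow>
    (\<forall>c. (\<Sum>i\<in>I. Poly_Mapping.single 0 (c i) * b i) \<in> P \<longrightarrow> (\<forall>i\<in>I. c i = 0))"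

lemma indep_mod_inj:
  fixes P :: "('v, 'k::field) mpoly set"
  assumes indep: "indep_mod P I b" and I: "finite I" and P: "0 \<in> P"
  shows "inj_on b I"
proof (rule inj_onI, rule ccontr)
  fix i j assume ij: "i \<in> I" "j \<in> I" "b i = b j" "i \<noteq> j"
  \<comment> \<open>These are the coefficients of the relation \<open>b i - b j = 0\<close>.\<close>
  let ?c = "\<lambda>k. if k = i then 1 else if k = j then - 1 else (0::'k)"
  have "(\<Sum>k\<in>I. Poly_Mapping.single 0 (?c k) * b k)
      = (\<Sum>k\<in>I. (if k = i then b k else 0) + (if k = j then - b k else 0))"
    using ij(4) by (intro sum.cong) (auto simp: single_uminus)
  also have "\<dots> = 0"
    using ij I by (simp add: sum.distrib)
  finally have "\<forall>k\<in>I. ?c k = 0"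
    using indep P unfolding indep_mod_def by (elim allE[of _ ?c]) simp
  from bspec[OF this ij(1)] show False
    by simp
qed

lemma indep_mod_image:
  assumes indep: "indep_mod P I b" and I: "finite I" and P: "0 \<in> P"
  shows "indep_mod P (b ` I) (\<lambda>x. x)"
  unfolding indep_mod_def
proof (intro allI impI)
  fix c assume "(\<Sum>x\<in>b ` I. Poly_Mapping.single 0 (c x) * x) \<in> P"
  then have "(\<Sum>i\<in>I. Poly_Mapping.single 0 (c (b i)) * b i) \<in> P"
    by (simp add: sum.reindex[OF indep_mod_inj[OF assms]])
  then have "\<forall>i\<in>I. c (b i) = 0"
    using indep unfolding indep_mod_def by (elim allE[of _ "\<lambda>i. c (b i)"]) simp
  then show "\<forall>x\<in>b ` I. c x = 0"
    by simp
qed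

text \<open>A relation modulo \<open>P\<close> is a polynomial in \<open>f\<close> with coefficients
  in the span of \<open>B\<close>. Modulo \<open>Q\<close> only its constant term survives, hence
  vanishes; then \<open>f\<close> cancels because \<open>P\<close> is prime and does not contain it,
  and the number of powers drops by one.\<close>

lemma indep_mod_powers:
  fixes B :: "('v, 'k::field) mpoly set"
  assumes P: "primeideal P (poly_ring V)" and Q: "ideal Q (poly_ring V)"
    and PQ: "P \<subseteq> Q" and f: "f \<in> Q" "f \<notin> P"
    and B: "finite B" "B \<subseteq> carrier (poly_ring V)" and indep: "indep_mod Q B (\<lambda>x. x)"
  shows "indep_mod P ({..<N} \<times> B) (\<lambda>(e, b). f ^ e * b)"
proof -
  have fV: "f \<in> carrier (poly_ring V)"
    using f(1) ideal_poly_ring_subset[OF Q] by auto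
  have prime: "\<And>a b. a \<in> carrier (poly_ring V) \<Longrightarrow> b \<in> carrier (poly_ring V) \<Longrightarrow> a * b \<in> P
      \<Longrightarrow> a \<in> P \<or> b \<in> P"
    using P by (auto simp: primeideal_poly_ring_iff)
  have *: "(\<Sum>e<N. f ^ e * (\<Sum>b\<in>B. Poly_Mapping.single 0 (c (e, b)) * b)) \<in> P
      \<Longrightarrow> \<forall>e<N. \<forall>b\<in>B. c (e, b) = 0" for c :: "nat \<times> ('v, 'k) mpoly \<Rightarrow> 'k"
  proof (induction N arbitrary: c)
    case (Suc N)
    let ?s = "\<lambda>e. \<Sum>b\<in>B. Poly_Mapping.single 0 (c (e, b)) * b"
    let ?r = "\<Sum>e<N. f ^ e * ?s (Suc e)"
    have rV: "?r \<in> carrier (poly_ring V)"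
      using B fV by (intro poly_ring_sum_closed poly_ring_closed(5)) auto
    have eq: "(\<Sum>e<Suc N. f ^ e * ?s e) = ?s 0 + f * ?r"
      by (simp only: sum.lessThan_Suc_shift sum_distrib_left power_Suc power_0 mult_1 mult.assoc)
    have "f * ?r \<in> Q"
      using ideal_poly_ring_mult[OF Q rV f(1)] by (simp add: mult.commute)
    moreover have "?s 0 + f * ?r \<in> Q"
      using Suc.prems PQ unfolding eq by auto
    ultimately have "?s 0 \<in> Q"
      using ideal_poly_ring_diff[OF Q, of "?s 0 + f * ?r" "f * ?r"] by simp
    then have c0: "\<forall>b\<in>B. c (0, b) = 0"
      using indep unfolding indep_mod_def by (elim allE[of _ "\<lambda>b. c (0, b)"]) simp
    then have "?s 0 = 0"
      by simp
    then have "f * ?r \<in> P"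
      using Suc.prems unfolding eq by simp
    then have "?r \<in> P"
      using prime[OF fV rV] f(2) by blast
    then have "\<forall>e<N. \<forall>b\<in>B. c (Suc e, b) = 0"
      using Suc.IH[of "\<lambda>(e, b). c (Suc e, b)"] by simp
    with c0 show ?case
      by (auto simp: less_Suc_eq_0_disj)
  qed simp
  have sum_eq: "(\<Sum>p\<in>{..<N} \<times> B. Poly_Mapping.single 0 (c p) * (case p of (e, b) \<Rightarrow> f ^ e * b))
      = (\<Sum>e<N. f ^ e * (\<Sum>b\<in>B. Poly_Mapping.single 0 (c (e, b)) * b))"
    for c :: "nat \<times> ('v, 'k) mpoly \<Rightarrow> 'k"
    by (simp add: sum.cartesian_product' sum_distrib_left mult.left_commute)
  show ?thesis
    unfolding indep_mod_def sum_eq using * by fastforce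
qed

text \<open>Descending the chain from \<open>C k\<close>, each step multiplies the number of
  elements by \<open>N\<close> and adds at most \<open>N * D\<close> to the exponents, since only
  powers below \<open>N\<close> of an element of \<open>box V D\<close> are used.\<close>

lemma indep_mod_chain:
  fixes B :: "('v, 'k::field) mpoly set"
  assumes C: "\<forall>i\<le>k. primeideal (C i) (poly_ring V)" "\<forall>i<k. C i \<subset> C (Suc i)"
    and f: "\<forall>i<k. f i \<in> C (Suc i) \<and> f i \<notin> C i \<and> f i \<in> box V D"
    and B: "finite B" "B \<subseteq> box V d" and indep: "indep_mod (C k) B (\<lambda>x. x)"
  shows "\<exists>B'. finite B' \<and> card B' = N ^ k * card B \<and> B' \<subseteq> box V (d + k * (N * D)) \<and>
    indep_mod (C 0) B' (\<lambda>x. x)"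
  using assms
proof (induction k arbitrary: B d)
  case 0
  then show ?case
    by auto
next
  case (Suc k)
  let ?I = "{..<N} \<times> B"
  let ?b = "\<lambda>(e, b). f k ^ e * b"
  have prime: "primeideal (C k) (poly_ring V)" "ideal (C k) (poly_ring V)"
      "ideal (C (Suc k)) (poly_ring V)"
    using Suc.prems(1) by (auto simp: primeideal_poly_ring_iff)
  have indep: "indep_mod (C k) ?I ?b"
    by (rule indep_mod_powers[OF prime(1,3)]) (use Suc.prems in \<open>auto simp: box_def\<close>)
  have fin: "finite ?I" and zero: "0 \<in> C k"
    using Suc.prems(4) ideal_poly_ring_zero[OF prime(2)] by auto
  have box: "?b ` ?I \<subseteq> box V (d + N * D)"
  proof clarify
    fix e b assume "e < N" "b \<in> B"
    have "f k \<in> box V D"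
      using Suc.prems(3) by simp
    then have "f k ^ e \<in> box V (N * D)"
      using \<open>e < N\<close> by (intro box_mono[OF _ box_power]) auto
    moreover have "b \<in> box V d"
      using Suc.prems(5) \<open>b \<in> B\<close> by auto
    ultimately show "f k ^ e * b \<in> box V (d + N * D)"
      using box_mult by (metis add.commute)
  qed
  have "\<exists>B'. finite B' \<and> card B' = N ^ k * card (?b ` ?I) \<and>
      B' \<subseteq> box V ((d + N * D) + k * (N * D)) \<and> indep_mod (C 0) B' (\<lambda>x. x)"
    by (rule Suc.IH) (use Suc.prems fin box indep_mod_image[OF indep fin zero] in auto)
  moreover have "card (?b ` ?I) = N * card B"
    using card_image[OF indep_mod_inj[OF indep fin zero]] by (simp add: card_cartesian_product)
  ultimately show ?case
    by (simp add: algebra_simps)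
qed

text \<open>A combination of these monomials lies in \<open>k[W]\<close>, where \<open>P\<close> has
  only 0, so it vanishes as a polynomial.\<close>

lemma indep_mod_monomials:
  fixes P :: "('v, 'k::field) mpoly set"
  assumes "finite W" "0 < N" "P \<inter> carrier (poly_ring W) \<subseteq> {0}"
  shows "indep_mod P (monomials W N) (\<lambda>m. Poly_Mapping.single m 1)"
  unfolding indep_mod_def
proof (intro allI impI ballI)
  fix c :: "('v \<Rightarrow>\<^sub>0 nat) \<Rightarrow> 'k" and m
  let ?s = "\<Sum>m\<in>monomials W N. Poly_Mapping.single m (c m)"
  assume "(\<Sum>m\<in>monomials W N. Poly_Mapping.single 0 (c m) * Poly_Mapping.single m 1) \<in> P"
    and m: "m \<in> monomials W N"
  then have "?s \<in> P"
    by (simp add: mult_single)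
  moreover have "?s \<in> carrier (poly_ring W)"
    by (intro poly_ring_sum_closed single_in_poly_ring) (simp add: monomials_def)
  ultimately have "?s = 0"
    using assms(3) by auto
  then have "Poly_Mapping.lookup ?s m = 0"
    by simp
  then show "c m = 0"
    using m card_monomials[OF assms(1,2)]
    by (simp add: lookup_sum lookup_single when_def)
qed

text \<open>Along a chain of primes below \<open>P\<close>, independent elements modulo \<open>P\<close> can be multiplied with powers
  of one new element per step. Counting dimensions in the space of polynomials whose exponents are
  at most \<open>O(N)\<close> bounds the length of the chain.\<close>

lemma prime_height_le:
  fixes P :: "('v, 'k::field) mpoly set"
  assumes V: "finite V" and W: "W \<subseteq> V" and PW: "P \<inter> carrier (poly_ring W) \<subseteq> {0}"
  shows "prime_height (poly_ring V) P \<le> enat (card V - card W)"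
  unfolding prime_height_def
proof (rule Sup_least, clarify)
  fix k C
  assume C: "\<forall>i\<le>k. C i \<in> Spec (poly_ring V)" "\<forall>i<k. C i \<subset> C (Suc i)" and P: "P = C k"
  have prime: "\<forall>i\<le>k. primeideal (C i) (poly_ring V)"
    using C(1) by (simp add: Spec_def)
  then have zero: "0 \<in> C i" if "i \<le> k" for i
    using that by (auto simp: primeideal_poly_ring_iff ideal_poly_ring_zero)
  have "\<exists>f D. i < k \<longrightarrow> f \<in> C (Suc i) \<and> f \<notin> C i \<and> f \<in> box V D" for i
  proof (cases "i < k")
    case True
    then obtain f where f: "f \<in> C (Suc i)" "f \<notin> C i"
      using C(2) by blast
    have "C (Suc i) \<subseteq> carrier (poly_ring V)"
      using prime True by (intro ideal_poly_ring_subset) (simp add: primeideal_poly_ring_iff)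
    then have "f \<in> carrier (poly_ring V)"
      using f by auto
    then show ?thesis
      using f by (metis box_exists)
  qed auto
  then obtain f D' where fD': "\<And>i. i < k \<Longrightarrow> f i \<in> C (Suc i) \<and> f i \<notin> C i \<and> f i \<in> box V (D' i)"
    by metis
  \<comment> \<open>One exponent bound for all the witnesses \<open>f i\<close>, chosen before
    \<open>N\<close>.\<close>
  define D where "D = (\<Sum>i<k. D' i)"
  have f: "\<forall>i<k. f i \<in> C (Suc i) \<and> f i \<notin> C i \<and> f i \<in> box V D"
  proof (intro allI impI)
    fix i assume "i < k"
    moreover from this have "D' i \<le> D"
      unfolding D_def by (intro member_le_sum) auto
    ultimately show "f i \<in> C (Suc i) \<and> f i \<notin> C i \<and> f i \<in> box V D"
      using fD'[of i] box_mono by blast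
  qed
  have finW: "finite W"
    using V W finite_subset by blast
  \<comment> \<open>The monomials in \<open>W\<close> are independent modulo \<open>P\<close>;
    carried down to \<open>C 0\<close>, they yield a set that is linearly independent in a
    box.\<close>
  have bound: "N ^ k * N ^ card W \<le> (N * (2 + k * D)) ^ card V" if N: "0 < N" for N
  proof -
    let ?b = "\<lambda>m. Poly_Mapping.single m (1::'k)"
    let ?M = "monomials W N"
    note cM = card_monomials[OF finW N]
    have indep: "indep_mod (C k) ?M ?b"
      using indep_mod_monomials[OF finW N PW] P by simp
    have "?b ` ?M \<subseteq> box V N"
      using W by (auto simp: box_def monomials_def less_imp_le intro!: single_in_poly_ring)
    then obtain B' where B': "finite B'" "card B' = N ^ k * card (?b ` ?M)"
      "B' \<subseteq> box V (N + k * (N * D))" "indep_mod (C 0) B' (\<lambda>x. x)"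
      using indep_mod_chain[OF prime C(2) f _ _ indep_mod_image[OF indep], of N N] cM zero by auto
    have "card (?b ` ?M) = N ^ card W"
      using card_image[OF indep_mod_inj[OF indep]] cM zero by simp
    moreover have "mpoly.independent B'"
      unfolding mpoly.dependent_finite[OF B'(1)]
      using B'(4) zero[of 0] by (auto simp: indep_mod_def)
    ultimately have "N ^ k * N ^ card W \<le> Suc (N + k * (N * D)) ^ card V"
      using card_independent_in_box[OF V B'(3)] B'(2) by simp
    also have "\<dots> \<le> (N * (2 + k * D)) ^ card V"
      using N by (intro power_mono) (auto simp: algebra_simps)
    finally show ?thesis .
  qed
  show "enat k \<le> enat (card V - card W)"
  proof (rule ccontr)
    assume "\<not> enat k \<le> enat (card V - card W)"
    then have k: "Suc (card V) \<le> k + card W"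
      by simp
    \<comment> \<open>If \<open>k + card W\<close> exceeds \<open>card V\<close>, then the left side
      of \<open>bound\<close> grows faster in \<open>N\<close> than the right side; any
      \<open>N\<close> above the constant \<open>?c\<close> gives the contradiction.\<close>
    let ?c = "(2 + k * D) ^ card V"
    let ?N = "Suc ?c"
    have "?N ^ card V * ?N \<le> ?N ^ (k + card W)"
      using power_increasing[OF k, of ?N] by (simp add: mult.commute)
    also have "\<dots> \<le> ?N ^ card V * ?c"
      using bound[of ?N] by (simp only: power_add power_mult_distrib)
    finally show False
      by simp
  qed
qed

section \<open>The ideal of \<open>2\<close>-minors\<close>

text \<open>The exponent of the image of a monomial under \<open>X\<^sub>i \<mapsto> s t\<^sub>i\<close>, \<open>Y\<^sub>i \<mapsto> t\<^sub>i\<close>; the variable \<open>s\<close>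
  has index 0.\<close>

definition exponent :: "nat \<Rightarrow> (nat \<times> nat \<Rightarrow>\<^sub>0 nat) \<Rightarrow> (nat \<Rightarrow>\<^sub>0 nat)" where
  "exponent n m = Poly_Mapping.single 0 (\<Sum>i=1..n. Poly_Mapping.lookup m (1, i)) +
     (\<Sum>i=1..n. Poly_Mapping.single i (Poly_Mapping.lookup m (1, i) + Poly_Mapping.lookup m (2, i)))"

text \<open>The Segre parametrization of \<open>2 x n\<close> matrices of rank at most one,
  dehomogenized by giving the second row the factor 1.\<close>

definition segre :: "nat \<Rightarrow> 'k::field matpoly \<Rightarrow> (nat \<Rightarrow>\<^sub>0 nat) \<Rightarrow>\<^sub>0 'k" where
  "segre n = lift (\<lambda>m. Poly_Mapping.single (exponent n m))"

lemma exponent_zero [simp]: "exponent n 0 = 0"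
  by (simp add: exponent_def)

lemma exponent_add: "exponent n (m + m') = exponent n m + exponent n m'"
  by (simp add: exponent_def lookup_add sum.distrib single_add ac_simps)

text \<open>The exponents of a monomial form a \<open>2 x n\<close> table; its image records the sum
  of the first row at index 0 and the column sums at the indices 1 to \<open>n\<close>.\<close>

lemma exponent_eq_iff:
  "exponent n m = exponent n m' \<longleftrightarrow>
    (\<Sum>i=1..n. Poly_Mapping.lookup m (1, i)) = (\<Sum>i=1..n. Poly_Mapping.lookup m' (1, i)) \<and>
    (\<forall>i\<in>{1..n}. Poly_Mapping.lookup m (1, i) + Poly_Mapping.lookup m (2, i) =
      Poly_Mapping.lookup m' (1, i) + Poly_Mapping.lookup m' (2, i))" (is "_ \<longleftrightarrow> ?R")
proof
  have zero: "Poly_Mapping.lookup (exponent n m) 0 = (\<Sum>i=1..n. Poly_Mapping.lookup m (1, i))"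
    for m
    by (simp add: exponent_def lookup_add lookup_sum lookup_single when_def)
  have col: "Poly_Mapping.lookup (exponent n m) i =
      Poly_Mapping.lookup m (1, i) + Poly_Mapping.lookup m (2, i)" if "i \<in> {1..n}" for m i
    using that by (simp add: exponent_def lookup_add lookup_sum lookup_single when_def)
  show ?R if "exponent n m = exponent n m'"
    using zero[of m] zero[of m'] col[of _ m] col[of _ m'] that by simp
  show "exponent n m = exponent n m'" if ?R
    using that unfolding exponent_def by (intro arg_cong2[where f = "(+)"] sum.cong) auto
qed

interpretation segre: monoid_algebra_hom
  "\<lambda>m. Poly_Mapping.single (exponent n m) :: 'k::field \<Rightarrow> _" for n
  by standard (simp_all add: single_add exponent_add mult_single)

lemma lookup_segre:
  "Poly_Mapping.lookup (segre n f) \<mu> =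
    (\<Sum>m\<in>Poly_Mapping.keys f. Poly_Mapping.lookup f m when exponent n m = \<mu>)"
  by (simp add: segre_def lift_def lookup_sum lookup_single)

lemma segre_minor:
  assumes "i \<in> {1..n}" "j \<in> {1..n}"
  shows "segre n (minor i j :: 'k::field matpoly) = 0"
proof -
  have "exponent n (Poly_Mapping.single (1, i) 1 + Poly_Mapping.single (2, j) 1) =
      exponent n (Poly_Mapping.single (2, i) 1 + Poly_Mapping.single (1, j) 1)"
    using assms by (auto simp: exponent_eq_iff lookup_add lookup_single when_def sum.distrib)
  then show ?thesis
    unfolding segre_def minor_def X_var_def Y_var_def indet_def
    by (simp add: segre.lift_diff mult_single)
qed

lemma XY_var_closed:
  assumes "i \<in> {1..n}"
  shows "X_var i \<in> carrier (S_ring n)" "Y_var i \<in> carrier (S_ring n)"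
  using assms unfolding X_var_def Y_var_def indet_def S_ring_def
  by (auto intro!: single_in_poly_ring)

lemma minor_flip: "minor j i = - minor i j"
  by (simp add: minor_def mult.commute)

lemma arcs_ends_verts:
  assumes "wf_digraph G" "(i, j) \<in> arcs_ends G"
  shows "i \<in> verts G \<and> j \<in> verts G"
proof -
  interpret wf_digraph G by fact
  show ?thesis
    using assms(2) by (auto simp: arcs_ends_conv)
qed

lemma edge_ideal_poly_ring:
  fixes G :: "(nat, 'e) pre_digraph"
  assumes "wf_digraph G" "verts G = {1..n}"
  shows "ideal (edge_ideal n G :: 'k::field matpoly set) (S_ring n)"
    and "(i, j) \<in> arcs_ends G \<Longrightarrow> (minor i j :: 'k matpoly) \<in> edge_ideal n G"
    and "ideal I (S_ring n) \<Longrightarrow> (\<And>i j. (i, j) \<in> arcs_ends G \<Longrightarrow> minor i j \<in> I) \<Longrightarrow>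
      (edge_ideal n G :: 'k matpoly set) \<subseteq> I"
proof -
  interpret wf_digraph G by fact
  let ?A = "{minor i j | i j. (i, j) \<in> arcs_ends G} :: 'k matpoly set"
  have "i \<in> {1..n} \<and> j \<in> {1..n}" if "(i, j) \<in> arcs_ends G" for i j
    using arcs_ends_verts[OF assms(1) that] assms(2) by simp
  then have sub: "?A \<subseteq> carrier (poly_ring ({1, 2} \<times> {1..n}))"
    using minor_in_carrier unfolding S_ring_def by blast
  show "ideal (edge_ideal n G :: 'k matpoly set) (S_ring n)"
    unfolding edge_ideal_def S_ring_def by (rule genideal_poly_ring(1)[OF sub])
  show "(minor i j :: 'k matpoly) \<in> edge_ideal n G" if "(i, j) \<in> arcs_ends G"
    unfolding edge_ideal_def S_ring_def using that
    by (intro subsetD[OF genideal_poly_ring(2)[OF sub]]) auto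
  show "(edge_ideal n G :: 'k matpoly set) \<subseteq> I"
    if "ideal I (S_ring n)" "\<And>i j. (i, j) \<in> arcs_ends G \<Longrightarrow> minor i j \<in> I"
    unfolding edge_ideal_def S_ring_def
    by (rule genideal_poly_ring(3)[OF sub]) (use that in \<open>auto simp: S_ring_def\<close>)
qed

text \<open>The generators of \<open>I2\<close> have \<open>i < j\<close>; equal indices give 0 and
  exchanged ones the negative, so all pairs of indices become available.\<close>

lemma I2_poly_ring:
  shows "ideal (I2 n :: 'k::field matpoly set) (S_ring n)"
    and "i \<in> {1..n} \<Longrightarrow> j \<in> {1..n} \<Longrightarrow> (minor i j :: 'k matpoly) \<in> I2 n"
    and "ideal I (S_ring n) \<Longrightarrow> (\<And>i j. i \<in> {1..n} \<Longrightarrow> j \<in> {1..n} \<Longrightarrow> minor i j \<in> I) \<Longrightarrow>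
      (I2 n :: 'k matpoly set) \<subseteq> I"
proof -
  let ?A = "{minor i j | i j. 1 \<le> i \<and> i < j \<and> j \<le> n} :: 'k matpoly set"
  have sub: "?A \<subseteq> carrier (poly_ring ({1, 2} \<times> {1..n}))"
    unfolding S_ring_def[symmetric] by (auto intro!: minor_in_carrier)
  show ideal: "ideal (I2 n :: 'k matpoly set) (S_ring n)"
    unfolding I2_def S_ring_def by (rule genideal_poly_ring(1)[OF sub])
  show "(I2 n :: 'k matpoly set) \<subseteq> I"
    if "ideal I (S_ring n)" "\<And>i j. i \<in> {1..n} \<Longrightarrow> j \<in> {1..n} \<Longrightarrow> minor i j \<in> I"
    unfolding I2_def S_ring_def
    by (rule genideal_poly_ring(3)[OF sub]) (use that in \<open>auto simp: S_ring_def\<close>)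
  have minor_I2: "(minor i j :: 'k matpoly) \<in> I2 n" if "1 \<le> i" "i < j" "j \<le> n" for i j
    unfolding I2_def S_ring_def using that
    by (intro subsetD[OF genideal_poly_ring(2)[OF sub]]) auto
  have zero: "(0 :: 'k matpoly) \<in> I2 n"
    using ideal ideal_poly_ring_zero unfolding S_ring_def by blast
  show "(minor i j :: 'k matpoly) \<in> I2 n" if ij: "i \<in> {1..n}" "j \<in> {1..n}"
  proof (cases i j rule: linorder_cases)
    case less
    then show ?thesis
      using minor_I2 ij by simp
  next
    case equal
    then show ?thesis
      using zero by (simp add: minor_def mult.commute)
  next
    case greater
    then have "(minor j i :: 'k matpoly) \<in> I2 n"
      using minor_I2 ij by simp
    then show ?thesis
      using ideal_poly_ring_diff[OF ideal[unfolded S_ring_def] zero] by (simp add: minor_flip[of i j])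
  qed
qed

text \<open>If some exponent of an \<open>X\<^sub>i\<close> is too large and that of an \<open>X\<^sub>j\<close> is too small, replacing
  \<open>X\<^sub>i Y\<^sub>j\<close> by \<open>Y\<^sub>i X\<^sub>j\<close> changes the monomial only modulo \<open>[i, j]\<close>.\<close>

lemma exponent_eq_imp_cong_I2:
  assumes "Poly_Mapping.keys m \<subseteq> {1, 2} \<times> {1..n}" "Poly_Mapping.keys m' \<subseteq> {1, 2} \<times> {1..n}"
    and "exponent n m = exponent n m'"
  shows "Poly_Mapping.single m c - Poly_Mapping.single m' c \<in> (I2 n :: 'k::field matpoly set)"
  using assms
\<comment> \<open>The measure is the total excess of the \<open>X\<close>-exponents of
  \<open>m\<close> over those of \<open>m'\<close>; subtraction of naturals ignores the
  deficits.\<close>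
proof (induction "\<Sum>i=1..n. Poly_Mapping.lookup m (1, i) - Poly_Mapping.lookup m' (1, i)"
    arbitrary: m rule: less_induct)
  case less
  note ideal = I2_poly_ring(1)[of n, where 'k = 'k, unfolded S_ring_def]
  let ?l = Poly_Mapping.lookup
  have rows: "(\<Sum>i=1..n. ?l m (1, i)) = (\<Sum>i=1..n. ?l m' (1, i))"
    and cols: "\<And>i. i \<in> {1..n} \<Longrightarrow> ?l m (1, i) + ?l m (2, i) = ?l m' (1, i) + ?l m' (2, i)"
    using less.prems(3) by (simp_all add: exponent_eq_iff)
  show ?case
  proof (cases "\<exists>i\<in>{1..n}. ?l m (1, i) \<noteq> ?l m' (1, i)")
    case False
    have "?l m v = ?l m' v" for v
    proof (cases "v \<in> {1, 2} \<times> {1..n}")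
      case True
      then show ?thesis
        using False cols by fastforce
    next
      case False
      then have "v \<notin> Poly_Mapping.keys m" "v \<notin> Poly_Mapping.keys m'"
        using less.prems(1,2) by auto
      then show ?thesis
        by (simp add: in_keys_iff)
    qed
    then have "m = m'"
      by (rule poly_mapping_eqI)
    then show ?thesis
      using ideal_poly_ring_zero[OF ideal] by simp
  next
    case True
    have "\<not> (\<forall>i\<in>{1..n}. ?l m (1, i) \<le> ?l m' (1, i))"
    proof
      assume le: "\<forall>i\<in>{1..n}. ?l m (1, i) \<le> ?l m' (1, i)"
      then have "(\<Sum>i=1..n. ?l m (1, i)) < (\<Sum>i=1..n. ?l m' (1, i))"
        using True by (intro sum_strict_mono_ex1) (auto simp: nat_less_le)
      then show False
        using rows by simp
    qed
    then obtain i where i: "i \<in> {1..n}" "?l m' (1, i) < ?l m (1, i)"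
      by force
    have "\<not> (\<forall>i\<in>{1..n}. ?l m' (1, i) \<le> ?l m (1, i))"
    proof
      assume "\<forall>i\<in>{1..n}. ?l m' (1, i) \<le> ?l m (1, i)"
      then have "(\<Sum>i=1..n. ?l m' (1, i)) < (\<Sum>i=1..n. ?l m (1, i))"
        using i by (intro sum_strict_mono_ex1) auto
      then show False
        using rows by simp
    qed
    then obtain j where j: "j \<in> {1..n}" "?l m (1, j) < ?l m' (1, j)"
      by force
    have "i \<noteq> j"
      using i j by auto
    let ?X = "\<lambda>i. Poly_Mapping.single (1 :: nat, i) (1 :: nat)"
    let ?Y = "\<lambda>i. Poly_Mapping.single (2 :: nat, i) (1 :: nat)"
    \<comment> \<open>The subtraction is exact: \<open>X_i\<close> occurs because of the excess at
      \<open>i\<close>, and \<open>Y_j\<close> occurs because column \<open>j\<close> has a deficit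
      in \<open>X_j\<close> but the same sum.\<close>
    define m0 where "m0 = m - (?X i + ?Y j)"
    have m: "m = m0 + (?X i + ?Y j)"
    proof (rule poly_mapping_eqI)
      fix v
      show "?l m v = ?l (m0 + (?X i + ?Y j)) v"
        using i(2) cols[OF j(1)] j(2)
        by (auto simp: m0_def lookup_add lookup_minus lookup_single when_def)
    qed
    define m1 where "m1 = m0 + (?Y i + ?X j)"
    have keys_m0: "Poly_Mapping.keys m0 \<subseteq> {1, 2} \<times> {1..n}"
      using less.prems(1) unfolding m
      by (auto simp: subset_iff in_keys_iff lookup_add)
    have keys_m1: "Poly_Mapping.keys m1 \<subseteq> {1, 2} \<times> {1..n}"
      using keys_m0 i(1) j(1) unfolding m1_def
      by (auto simp: subset_iff in_keys_iff lookup_add lookup_single when_def split: if_splits)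
    have m1: "exponent n m1 = exponent n m'"
    proof -
      have "exponent n (?Y i + ?X j) = exponent n (?X i + ?Y j)"
        using i(1) j(1) by (auto simp: exponent_eq_iff lookup_add lookup_single when_def sum.distrib)
      then show ?thesis
        using less.prems(3) by (simp add: m m1_def exponent_add)
    qed
    have l1: "?l m (1, k) = ?l m0 (1, k) + (if k = i then 1 else 0)"
      "?l m1 (1, k) = ?l m0 (1, k) + (if k = j then 1 else 0)" for k
      by (auto simp: m m1_def lookup_add lookup_single when_def)
    \<comment> \<open>The exchange lowers the excess at \<open>i\<close> by one; at \<open>j\<close>
      there is a deficit, so one more \<open>X_j\<close> creates no excess.\<close>
    have "(\<Sum>k=1..n. ?l m1 (1, k) - ?l m' (1, k)) < (\<Sum>k=1..n. ?l m (1, k) - ?l m' (1, k))"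
    proof (rule sum_strict_mono_ex1)
      show "\<forall>k\<in>{1..n}. ?l m1 (1, k) - ?l m' (1, k) \<le> ?l m (1, k) - ?l m' (1, k)"
        using j(2) \<open>i \<noteq> j\<close> l1 by auto
      show "\<exists>k\<in>{1..n}. ?l m1 (1, k) - ?l m' (1, k) < ?l m (1, k) - ?l m' (1, k)"
        using i \<open>i \<noteq> j\<close> l1 by (intro bexI[of _ i]) auto
    qed simp
    then have IH: "Poly_Mapping.single m1 c - Poly_Mapping.single m' c \<in> (I2 n :: 'k matpoly set)"
      by (rule less.hyps[OF _ keys_m1 less.prems(2) m1])
    have "Poly_Mapping.single m c - Poly_Mapping.single m1 c = Poly_Mapping.single m0 c * minor i j"
      unfolding minor_def X_var_def Y_var_def indet_def m m1_def
      by (simp add: right_diff_distrib mult_single)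
    moreover have "Poly_Mapping.single m0 c * minor i j \<in> (I2 n :: 'k matpoly set)"
      using keys_m0 by (intro ideal_poly_ring_mult[OF ideal] I2_poly_ring(2) i(1) j(1)) auto
    ultimately have "Poly_Mapping.single m c - Poly_Mapping.single m1 c \<in> (I2 n :: 'k matpoly set)"
      by simp
    from ideal_poly_ring_add[OF ideal this IH] show ?thesis
      by simp
  qed
qed

text \<open>Monomials with the same image are congruent modulo \<open>I2\<close>, so each monomial
  of \<open>f\<close> may be replaced by a chosen representative \<open>r\<close> with that image.
  The coefficients collected there are those of \<open>segre n f\<close>, hence 0.\<close>

lemma I2_eq_kernel:
  "(I2 n :: 'k::field matpoly set) = {f \<in> carrier (S_ring n). segre n f = 0}" (is "_ = ?K")
proof
  note ideal = I2_poly_ring(1)[of n, where 'k = 'k, unfolded S_ring_def]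
  have "ideal ?K (S_ring n)"
    unfolding S_ring_def ideal_poly_ring_iff
    by (auto simp: segre_def segre.lift_add segre.lift_mult)
  then show "I2 n \<subseteq> ?K"
    by (rule I2_poly_ring(3)) (auto simp: segre_minor minor_in_carrier)
  show "?K \<subseteq> I2 n"
  proof clarify
    fix f :: "'k matpoly" assume f: "f \<in> carrier (S_ring n)" "segre n f = 0"
    let ?k = "Poly_Mapping.keys f" and ?l = "Poly_Mapping.lookup f"
    define r where "r \<mu> = (SOME m. m \<in> ?k \<and> exponent n m = \<mu>)" for \<mu>
    have r: "r (exponent n m) \<in> ?k \<and> exponent n (r (exponent n m)) = exponent n m" if "m \<in> ?k" for m
      unfolding r_def by (rule someI[of _ m]) (use that in simp)
    have "(\<Sum>m\<in>?k. Poly_Mapping.single (r (exponent n m)) (?l m)) =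
        (\<Sum>\<mu>\<in>exponent n ` ?k. \<Sum>m\<in>{m \<in> ?k. exponent n m = \<mu>}. Poly_Mapping.single (r (exponent n m)) (?l m))"
      by (rule sum.image_gen) simp
    also have "\<dots> = (\<Sum>\<mu>\<in>exponent n ` ?k. Poly_Mapping.single (r \<mu>) (\<Sum>m\<in>{m \<in> ?k. exponent n m = \<mu>}. ?l m))"
      by (intro sum.cong refl poly_mapping_eqI) (simp add: lookup_sum lookup_single when_def)
    also have "\<dots> = (\<Sum>\<mu>\<in>exponent n ` ?k. Poly_Mapping.single (r \<mu>) (Poly_Mapping.lookup (segre n f) \<mu>))"
      by (simp add: lookup_segre when_def sum.inter_filter)
    finally have zero: "(\<Sum>m\<in>?k. Poly_Mapping.single (r (exponent n m)) (?l m)) = 0"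
      by (simp add: f(2))
    have "f = (\<Sum>m\<in>?k. Poly_Mapping.single m (?l m)) - (\<Sum>m\<in>?k. Poly_Mapping.single (r (exponent n m)) (?l m))"
      by (simp only: zero poly_mapping_sum_single diff_zero)
    also have "\<dots> = (\<Sum>m\<in>?k. Poly_Mapping.single m (?l m) - Poly_Mapping.single (r (exponent n m)) (?l m))"
      by (simp add: sum_subtractf)
    also have "\<dots> \<in> I2 n"
      using f(1) r unfolding S_ring_def carrier_poly_ring
      by (intro ideal_poly_ring_sum[OF ideal] exponent_eq_imp_cong_I2) auto
    finally show "f \<in> I2 n" .
  qed
qed

lemma I2_prime: "primeideal (I2 n :: 'k::field matpoly set) (S_ring n)"
  unfolding S_ring_def primeideal_poly_ring_iff
proof (intro conjI ballI impI)
  show "ideal (I2 n :: 'k matpoly set) (poly_ring ({1, 2} \<times> {1..n}))"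
    using I2_poly_ring(1) unfolding S_ring_def .
  show "(1 :: 'k matpoly) \<notin> I2 n"
    by (simp add: I2_eq_kernel segre_def)
  fix a b :: "'k matpoly"
  assume "a \<in> carrier (poly_ring ({1, 2} \<times> {1..n}))" "b \<in> carrier (poly_ring ({1, 2} \<times> {1..n}))"
    and "a * b \<in> I2 n"
  then show "a \<in> I2 n \<or> b \<in> I2 n"
    by (auto simp: I2_eq_kernel segre_def segre.lift_mult S_ring_def)
qed

lemma prime_height_I2_le:
  assumes "0 < n"
  shows "prime_height (S_ring n) (I2 n :: 'k::field matpoly set) \<le> enat (n - 1)"
proof -
  let ?V = "{1, 2} \<times> {1..n} :: (nat \<times> nat) set"
  let ?W = "insert (2, 1) ({1} \<times> {1..n}) :: (nat \<times> nat) set"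
  \<comment> \<open>In the columns other than the first, \<open>Y\<close> is absent, so the column
    sums give the \<open>X\<close>-exponents; the row sum then gives that of \<open>X_1\<close>, and
    the first column sum that of \<open>Y_1\<close>.\<close>
  have inj: "m = m'" if m: "Poly_Mapping.keys m \<subseteq> ?W" "Poly_Mapping.keys m' \<subseteq> ?W"
    and eq: "exponent n m = exponent n m'" for m m'
  proof (rule poly_mapping_eqI)
    fix v
    let ?l = Poly_Mapping.lookup
    have zero: "?l m v = 0" "?l m' v = 0" if "v \<notin> ?W" for v
    proof -
      have "v \<notin> Poly_Mapping.keys m" "v \<notin> Poly_Mapping.keys m'"
        using m that by blast+
      then show "?l m v = 0" "?l m' v = 0"
        by (simp_all add: in_keys_iff)
    qed
    have cols: "?l m (1, i) + ?l m (2, i) = ?l m' (1, i) + ?l m' (2, i)" if "i \<in> {1..n}" for i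
      using eq that by (simp add: exponent_eq_iff)
    have X: "?l m (1, i) = ?l m' (1, i)" if "i \<in> {1..n} - {1}" for i
      using cols[of i] zero[of "(2, i)"] that by auto
    have X1: "?l m (1, 1) = ?l m' (1, 1)"
    proof -
      have rows: "(\<Sum>i=1..n. ?l m (1, i)) = (\<Sum>i=1..n. ?l m' (1, i))"
        using eq by (simp add: exponent_eq_iff)
      have split: "(\<Sum>i=1..n. ?l m (1, i)) = ?l m (1, 1) + (\<Sum>i\<in>{1..n} - {1}. ?l m (1, i))"
        for m :: "nat \<times> nat \<Rightarrow>\<^sub>0 nat"
        using assms by (intro sum.remove) auto
      have "(\<Sum>i\<in>{1..n} - {1}. ?l m (1, i)) = (\<Sum>i\<in>{1..n} - {1}. ?l m' (1, i))"
        by (intro sum.cong refl X)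
      then show ?thesis
        using rows split[of m] split[of m'] by linarith
    qed
    have Y1: "?l m (2, 1) = ?l m' (2, 1)"
      using cols[of 1] X1 assms by simp
    consider "v \<notin> ?W" | "v = (2, 1)" | "v = (1, 1)" | i where "v = (1, i)" "i \<in> {1..n} - {1}"
      by (cases v) auto
    then show "?l m v = ?l m' v"
    proof cases
      case 1
      then show ?thesis
        using zero by simp
    qed (use X X1 Y1 in simp_all)
  qed
  have "I2 n \<inter> carrier (poly_ring ?W) \<subseteq> {0 :: 'k matpoly}"
  proof clarify
    fix f :: "'k matpoly" assume f: "f \<in> I2 n" "f \<in> carrier (poly_ring ?W)"
    show "f = 0"
    proof (rule ccontr)
      assume "f \<noteq> 0"
      then obtain m where m: "m \<in> Poly_Mapping.keys f"
        using keys_eq_empty[of f] by blast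
      have "0 = Poly_Mapping.lookup (segre n f) (exponent n m)"
        using f(1) by (simp add: I2_eq_kernel)
      also have "\<dots> = (\<Sum>m'\<in>Poly_Mapping.keys f. Poly_Mapping.lookup f m' when m' = m)"
        unfolding lookup_segre
      proof (intro sum.cong refl when_cong)
        fix m' assume "m' \<in> Poly_Mapping.keys f"
        then have "Poly_Mapping.keys m' \<subseteq> ?W" "Poly_Mapping.keys m \<subseteq> ?W"
          using f(2) m by (simp_all add: carrier_poly_ring)
        then show "exponent n m' = exponent n m \<longleftrightarrow> m' = m"
          using inj by blast
      qed
      also have "\<dots> = Poly_Mapping.lookup f m"
        using m by (simp add: when_def)
      finally show False
        using m by (simp add: in_keys_iff)
    qed
  qed
  then have "prime_height (S_ring n) (I2 n :: 'k matpoly set) \<le> enat (card ?V - card ?W)"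
    unfolding S_ring_def using assms by (intro prime_height_le) auto
  also have "card ?V - card ?W = n - 1"
    by (simp add: card_cartesian_product card_insert_if)
  finally show ?thesis .
qed

section \<open>Hamilton cycles\<close>

text \<open>Consecutive arcs of a walk share a vertex. For a closed walk the list of heads thus
  becomes a rotation of the list of tails.\<close>

lemma (in pre_digraph) cas_tails_heads:
  "cas u p v \<Longrightarrow> u # map (head G) p = map (tail G) p @ [v]"
  by (induction u p v rule: cas.induct) auto

text \<open>Cutting the Hamilton cycle before \<open>u\<close> leaves a Hamilton path that starts at
  \<open>u\<close>.\<close>

lemma hamilton_cycle_enumeration:
  assumes "has_hamilton_cycle G" "u \<in> verts G"
  shows "\<exists>ws. distinct ws \<and> set ws = verts G \<and> ws ! 0 = u \<and>
    (\<forall>k. Suc k < length ws \<longrightarrow> (ws ! k, ws ! Suc k) \<in> arcs_ends G)"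
proof -
  interpret pre_digraph G .
  obtain p w where p: "cas w p w" "set p \<subseteq> arcs G" "p \<noteq> []" "distinct (tl (awalk_verts w p))"
    "tail G ` set p = verts G"
    using assms(1) by (auto simp: has_hamilton_cycle_def cycle_def awalk_def)
  let ?t = "map (tail G) p"
  have heads: "map (head G) p = rotate1 ?t"
    using cas_tails_heads[OF p(1)] p(3) by (cases p) auto
  \<comment> \<open>The definition of a cycle makes the heads distinct; by the rotation, so are the
    tails.\<close>
  have "tl (awalk_verts w p) = map (head G) p"
    using p(1,3) by (simp add: awalk_verts_conv')
  then have dist: "distinct ?t"
    using p(4) heads by (metis distinct1_rotate)
  have arc: "(?t ! k, ?t ! (Suc k mod length p)) \<in> arcs_ends G" if k: "k < length p" for k
  proof -
    have "?t ! (Suc k mod length p) = head G (p ! k)"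
      using k nth_map[OF k, of "head G"] nth_rotate1[of k ?t] by (simp add: heads)
    moreover have "p ! k \<in> arcs G"
      using p(2) k by auto
    ultimately show ?thesis
      using k by (auto simp: arcs_ends_conv)
  qed
  obtain r where r: "r < length p" "?t ! r = u"
    using assms(2) p(5) by (metis in_set_conv_nth length_map set_map)
  show ?thesis
  proof (intro exI conjI allI impI)
    let ?w = "rotate r ?t"
    show "distinct ?w" "set ?w = verts G"
      using dist p(5) by simp_all
    show "?w ! 0 = u"
      using r p(3) nth_rotate[of 0 ?t r] by simp
    fix k assume k: "Suc k < length ?w"
    then have "?w ! k = ?t ! ((r + k) mod length p)" "?w ! Suc k = ?t ! (Suc ((r + k) mod length p) mod length p)"
      using nth_rotate[of k ?t r] nth_rotate[of "Suc k" ?t r] by (simp_all add: mod_Suc_eq)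
    then show "(?w ! k, ?w ! Suc k) \<in> arcs_ends G"
      using arc[of "(r + k) mod length p"] p(3) by simp
  qed
qed

text \<open>Over the fraction field of \<open>S/P\<close>, column \<open>j\<close> is nonzero, and
  two columns proportional to the same nonzero column are proportional to each other.\<close>

lemma minor_trans:
  fixes P :: "'k::field matpoly set"
  assumes P: "primeideal P (S_ring n)" and ijk: "i \<in> {1..n}" "j \<in> {1..n}" "k \<in> {1..n}"
    and j: "X_var j \<notin> P \<or> Y_var j \<notin> P" and minors: "minor i j \<in> P" "minor j k \<in> P"
  shows "minor i k \<in> P"
proof -
  have ideal: "ideal P (poly_ring ({1, 2} \<times> {1..n}))"
    and prime: "\<And>a b. a \<in> carrier (S_ring n) \<Longrightarrow> b \<in> carrier (S_ring n) \<Longrightarrow> a * b \<in> P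
      \<Longrightarrow> a \<in> P \<or> b \<in> P"
    using P by (auto simp: primeideal_poly_ring_iff S_ring_def)
  have comb: "a * minor j k + b * minor i j \<in> P"
    if "a \<in> carrier (S_ring n)" "b \<in> carrier (S_ring n)" for a b
    using that minors unfolding S_ring_def
    by (intro ideal_poly_ring_add[OF ideal] ideal_poly_ring_mult[OF ideal])
  have "X_var j * minor i k = X_var i * minor j k + X_var k * (minor i j :: 'k matpoly)"
    "Y_var j * minor i k = Y_var i * minor j k + Y_var k * (minor i j :: 'k matpoly)"
    by (simp_all add: minor_def algebra_simps)
  then have "X_var j * minor i k \<in> P" "Y_var j * minor i k \<in> P"
    using comb[OF XY_var_closed(1)[OF ijk(1)] XY_var_closed(1)[OF ijk(3)]]
      comb[OF XY_var_closed(2)[OF ijk(1)] XY_var_closed(2)[OF ijk(3)]] by simp_all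
  then show ?thesis
    using prime[OF XY_var_closed(1)[OF ijk(2)] minor_in_carrier[OF ijk(1,3)]]
      prime[OF XY_var_closed(2)[OF ijk(2)] minor_in_carrier[OF ijk(1,3)]] j by blast
qed

text \<open>Over \<open>k[W]\<close> the minor is linear in the new variables, with coefficients
  \<open>X_i\<close> at \<open>Y_j\<close> and \<open>- Y_i\<close> at \<open>X_j\<close>;
  membership would put both into \<open>P\<close>.\<close>

lemma minor_notin_ext_contr:
  fixes P :: "'k::field matpoly set"
  assumes P: "ideal P (poly_ring V)" and WV: "W \<subseteq> V"
    and i: "(1, i) \<in> W" "(2, i) \<in> W" and j: "(1, j) \<notin> W" "(2, j) \<notin> W"
    and XY: "X_var i \<notin> P \<or> Y_var i \<notin> P"
  shows "minor i j \<notin> ext_contr V P W"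
proof
  assume "minor i j \<in> ext_contr V P W"
  then have coeff: "Poly_Mapping.lookup (split_vars W (minor i j)) \<mu> \<in> P" for \<mu>
    using ext_contr_iff[OF P WV] by blast
  have "(X_var i :: 'k matpoly) \<in> carrier (poly_ring W)" "(Y_var i :: 'k matpoly) \<in> carrier (poly_ring W)"
    using i unfolding X_var_def Y_var_def indet_def by (auto intro!: single_in_poly_ring)
  note XY_coeff = this[THEN split_vars_coeff_ring]
  have "split_vars W (minor i j :: 'k matpoly) =
      Poly_Mapping.single 0 (X_var i) * indet (2, j) - Poly_Mapping.single 0 (Y_var i) * indet (1, j)"
    unfolding minor_def X_var_def[of j] Y_var_def[of j]
    by (simp only: split_vars_diff split_vars_mult split_vars_indet[OF j(1)] split_vars_indet[OF j(2)]
        XY_coeff)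
  then have "split_vars W (minor i j :: 'k matpoly) =
      Poly_Mapping.single (Poly_Mapping.single (2, j) 1) (X_var i) -
      Poly_Mapping.single (Poly_Mapping.single (1, j) 1) (Y_var i :: 'k matpoly)"
    by (simp add: indet_def mult_single)
  moreover have "Poly_Mapping.single (2 :: nat, j) (1 :: nat) \<noteq> Poly_Mapping.single (1, j) 1"
  proof
    assume "Poly_Mapping.single (2 :: nat, j) (1 :: nat) = Poly_Mapping.single (1, j) 1"
    then have "Poly_Mapping.lookup (Poly_Mapping.single (2 :: nat, j) (1 :: nat)) (1, j) = 1"
      by simp
    then show False
      by (simp add: lookup_single)
  qed
  ultimately have "X_var i \<in> P" "- Y_var i \<in> P"
    using coeff[of "Poly_Mapping.single (2, j) 1"] coeff[of "Poly_Mapping.single (1, j) 1"]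
    by (simp_all add: lookup_minus lookup_single when_def)
  then show False
    using XY ideal_poly_ring_diff[OF P ideal_poly_ring_zero[OF P], of "- Y_var i"] by simp
qed

text \<open>Adjoining the variables of one vertex after the other, the height of \<open>ext_contr\<close> grows by 2 at
  a vertex whose variables both lie in \<open>P\<close>, and by at least 1 at a vertex whose predecessor is not
  of this kind.\<close>

lemma prime_height_ge:
  fixes P :: "'k::field matpoly set"
  assumes P: "primeideal P (S_ring n)"
    and ws: "distinct ws" "set ws = {1..n}"
    and minors: "\<And>k. Suc k < n \<Longrightarrow> minor (ws ! k) (ws ! Suc k) \<in> P"
    and first: "X_var (ws ! 0) \<in> P" "Y_var (ws ! 0) \<in> P" and n: "0 < n"
  shows "enat n \<le> prime_height (S_ring n) P"
proof -
  let ?V = "{1, 2} \<times> {1..n} :: (nat \<times> nat) set"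
  let ?w = "\<lambda>k. ws ! k"
  define W :: "nat \<Rightarrow> (nat \<times> nat) set" where "W k = {1, 2} \<times> ?w ` {..<k}" for k
  let ?h = "\<lambda>W. prime_height (poly_ring ?V) (ext_contr ?V P W)"
  define U where "U = {i. X_var i \<in> P \<and> Y_var i \<in> P}"
  have prime: "primeideal P (poly_ring ?V)" and ideal: "ideal P (poly_ring ?V)"
    using P by (auto simp: S_ring_def primeideal_poly_ring_iff)
  have len: "length ws = n"
    using distinct_card[OF ws(1)] ws(2) by simp
  have wn: "?w k \<in> {1..n}" if "k < n" for k
    using that len ws(2) nth_mem by metis
  have WV: "W k \<subseteq> ?V" if "k \<le> n" for k
    using wn that by (auto simp: W_def)
  have new: "(a, ?w k) \<notin> W k" if "k < n" for a k
    using that ws(1) len by (auto simp: W_def nth_eq_iff_index_eq)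
  \<comment> \<open>The extra 1 is a credit: a vertex of \<open>U\<close> adds 2, and the surplus
    pays for a following vertex outside \<open>U\<close>, which may add nothing.\<close>
  have "enat (k + (if 0 < k \<and> ?w (k - 1) \<in> U then 1 else 0)) \<le> ?h (W k)" if "k \<le> n" for k
    using that
  proof (induction k)
    case 0
    then show ?case
      by (simp add: zero_enat_def[symmetric])
  next
    case (Suc k)
    let ?i = "?w k"
    have k: "k < n" and W: "W k \<subseteq> W (Suc k)" "W (Suc k) \<subseteq> ?V"
      using Suc.prems WV[of "Suc k"] by (auto simp: W_def)
    have XYk: "X_var ?i \<in> carrier (poly_ring (W (Suc k)))" "Y_var ?i \<in> carrier (poly_ring (W (Suc k)))"
      unfolding X_var_def Y_var_def indet_def by (auto simp: W_def intro!: single_in_poly_ring)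
    \<comment> \<open>For \<open>k = 0\<close> only the first case remains, as the starting vertex
      lies in \<open>U\<close>.\<close>
    consider "?i \<in> U" | "0 < k" "?i \<notin> U" "?w (k - 1) \<in> U" | "0 < k" "?i \<notin> U" "?w (k - 1) \<notin> U"
      using first by (cases "k = 0") (auto simp: U_def)
    then show ?case
    proof cases
      case 1
      \<comment> \<open>The two variables are adjoined one at a time, for two strict
        inclusions.\<close>
      let ?W = "insert (1, ?i) (W k)"
      have W': "W k \<subseteq> ?W" "?W \<subseteq> W (Suc k)" "?W \<subseteq> ?V"
      proof -
        show "W k \<subseteq> ?W" "?W \<subseteq> W (Suc k)"
          by (auto simp: W_def)
        then show "?W \<subseteq> ?V"
          using W(2) by blast
      qed
      have "?h (W k) + 1 \<le> ?h ?W"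
      proof (rule prime_height_ext_contr_step[OF prime W'(1,3)])
        show "X_var ?i \<in> P"
          using 1 by (simp add: U_def)
        show "X_var ?i \<in> carrier (poly_ring ?W)"
          unfolding X_var_def indet_def by (auto intro!: single_in_poly_ring)
        show "X_var ?i \<notin> ext_contr ?V P (W k)"
          unfolding X_var_def by (rule indet_notin_ext_contr[OF prime]) (use W new[OF k] in auto)
      qed
      moreover have "?h ?W + 1 \<le> ?h (W (Suc k))"
      proof (rule prime_height_ext_contr_step[OF prime W'(2) W(2) _ XYk(2)])
        show "Y_var ?i \<in> P"
          using 1 by (simp add: U_def)
        show "Y_var ?i \<notin> ext_contr ?V P ?W"
          unfolding Y_var_def by (rule indet_notin_ext_contr[OF prime W'(3)]) (use new[OF k] in auto)
      qed
      moreover have "enat k \<le> ?h (W k)"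
        using Suc.IH k by (auto intro: order_trans[rotated])
      ultimately have "enat k + 1 + 1 \<le> ?h (W (Suc k))"
        by (meson add_right_mono order_trans)
      then show ?thesis
        using 1 by (simp add: one_enat_def)
    next
      case 2
      \<comment> \<open>Here the credit of the predecessor is spent.\<close>
      have "enat (Suc k) \<le> ?h (W k)"
        using Suc.IH k 2 by simp
      also have "\<dots> \<le> ?h (W (Suc k))"
        using ext_contr_prime[OF prime W(2)] ext_contr_mono[OF W]
        by (intro prime_height_mono) (auto simp: Spec_def)
      finally show ?thesis
        using 2 by simp
    next
      case 3
      let ?j = "?w (k - 1)"
      have "?h (W k) + 1 \<le> ?h (W (Suc k))"
      proof (rule prime_height_ext_contr_step[OF prime W])
        show "minor ?j ?i \<in> P"
          using minors[of "k - 1"] 3(1) k by simp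
        have j: "(1, ?j) \<in> W k" "(2, ?j) \<in> W k"
          using 3(1) by (auto simp: W_def)
        then have "X_var ?j \<in> carrier (poly_ring (W (Suc k)))" "Y_var ?j \<in> carrier (poly_ring (W (Suc k)))"
          unfolding X_var_def Y_var_def indet_def using W(1) by (auto intro!: single_in_poly_ring)
        then show "minor ?j ?i \<in> carrier (poly_ring (W (Suc k)))"
          unfolding minor_def using XYk by auto
        show "minor ?j ?i \<notin> ext_contr ?V P (W k)"
          using 3 W new[OF k] j by (intro minor_notin_ext_contr[OF ideal]) (auto simp: U_def)
      qed
      moreover have "enat k \<le> ?h (W k)"
        using Suc.IH k by (auto intro: order_trans[rotated])
      ultimately have "enat k + 1 \<le> ?h (W (Suc k))"
        by (meson add_right_mono order_trans)
      then show ?thesis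
        using 3 by (simp add: one_enat_def)
    qed
  qed
  from this[of n] have "enat n \<le> ?h (W n)"
    using order_trans[of "enat n" "enat (n + 1)"] by (auto split: if_splits)
  moreover have "W n = ?V"
    using ws(2) len by (auto simp: W_def set_conv_nth)
  ultimately show ?thesis
    using ext_contr_all[OF ideal] by (simp add: S_ring_def)
qed

section \<open>Primes containing the edge ideal of a Hamiltonian graph\<close>

theorem proposition5p5:
  fixes n :: nat and G :: "(nat, 'e) pre_digraph"
  assumes "n > 2"
    and "Digraph.graph G" and "verts G = {1..n}"
    and "Digraph_Component.connected G"
    and "has_hamilton_cycle G"
  shows "Assh (S_ring n) (edge_ideal n G) = {I2 n :: 'k::field matpoly set}"
proof -
  interpret graph G by fact
  let ?R = "S_ring n :: 'k matpoly ring" and ?E = "edge_ideal n G :: 'k matpoly set"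
  let ?I = "I2 n :: 'k matpoly set"
  note E = edge_ideal_poly_ring[OF wf_digraph assms(3), where 'k = 'k]
  have Spec_I2: "?I \<in> Spec ?R"
    by (simp add: Spec_def I2_prime)
  \<comment> \<open>The gap between \<open>n - 1\<close> and \<open>n\<close> separates
    \<open>I2\<close> from the primes that contain both variables of some vertex.\<close>
  have ht_I2: "prime_height ?R ?I < enat n"
    using prime_height_I2_le[of n, where 'k = 'k] assms(1) by (auto intro: le_less_trans)
  have E_I2: "?E \<subseteq> ?I"
  proof (rule E(3)[OF I2_poly_ring(1)])
    fix i j assume "(i, j) \<in> arcs_ends G"
    then have "i \<in> {1..n}" "j \<in> {1..n}"
      using arcs_ends_verts[OF wf_digraph] assms(3) by simp_all
    then show "minor i j \<in> ?I"
      by (rule I2_poly_ring(2))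
  qed
  note enum = hamilton_cycle_enumeration[OF assms(5), unfolded assms(3)]
  have dichotomy: "?I \<subseteq> P \<or> enat n \<le> prime_height ?R P" if P: "P \<in> Spec ?R" "?E \<subseteq> P" for P
  proof (cases "\<exists>u\<in>{1..n}. X_var u \<in> P \<and> Y_var u \<in> P")
    case True
    then obtain u where u: "u \<in> {1..n}" "X_var u \<in> P" "Y_var u \<in> P"
      by blast
    obtain ws where ws: "distinct ws" "set ws = {1..n}" "ws ! 0 = u"
      "\<forall>k. Suc k < length ws \<longrightarrow> (ws ! k, ws ! Suc k) \<in> arcs_ends G"
      using enum[OF u(1)] by (elim exE conjE) (rule that)
    have len: "length ws = n"
      using distinct_card[OF ws(1)] ws(2) by simp
    have "enat n \<le> prime_height ?R P"
    proof (rule prime_height_ge[OF _ ws(1,2)])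
      show "primeideal P ?R" "X_var (ws ! 0) \<in> P" "Y_var (ws ! 0) \<in> P" "0 < n"
        using P u ws(3) assms(1) by (auto simp: Spec_def)
      show "minor (ws ! k) (ws ! Suc k) \<in> P" if "Suc k < n" for k
        using E(2)[OF ws(4)[rule_format], of k] that len P(2) by auto
    qed
    then show ?thesis
      by simp
  next
    case False
    have one: "1 \<in> {1..n}"
      using assms(1) by simp
    obtain ws where ws: "distinct ws" "set ws = {1..n}" "ws ! 0 = 1"
      "\<forall>k. Suc k < length ws \<longrightarrow> (ws ! k, ws ! Suc k) \<in> arcs_ends G"
      using enum[OF one] by (elim exE conjE) (rule that)
    have len: "length ws = n"
      using distinct_card[OF ws(1)] ws(2) by simp
    have wn: "ws ! k \<in> {1..n}" if "k < n" for k
      using that len ws(2) nth_mem by metis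
    have prime: "primeideal P ?R" and ideal: "ideal P ?R"
      using P(1) by (auto simp: Spec_def S_ring_def primeideal_poly_ring_iff)
    note ideal' = ideal[unfolded S_ring_def]
    have step: "minor i k \<in> P" if "i \<in> {1..n}" "j \<in> {1..n}" "k \<in> {1..n}"
      "minor i j \<in> P" "minor j k \<in> P" for i j k
      by (rule minor_trans[OF prime that(1-3) _ that(4,5)]) (use False that in auto)
    \<comment> \<open>\<open>minor_trans\<close> carries the minors along the path, from its first
      vertex to all others.\<close>
    have *: "minor (ws ! 0) (ws ! k) \<in> P" if "k < n" for k
      using that
    proof (induction k)
      case 0
      then show ?case
        using ideal_poly_ring_zero[OF ideal'] by (simp add: minor_def mult.commute)
    next
      case (Suc k)
      have "minor (ws ! k) (ws ! Suc k) \<in> P"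
        using E(2)[OF ws(4)[rule_format], of k] Suc.prems len P(2) by auto
      with Suc show ?case
        using wn[of 0] wn[of k] wn[of "Suc k"] step[of "ws ! 0" "ws ! k" "ws ! Suc k"] by simp
    qed
    have "?I \<subseteq> P"
    proof (rule I2_poly_ring(3)[OF ideal])
      fix i j assume ij: "i \<in> {1..n}" "j \<in> {1..n}"
      have "\<exists>a<n. ws ! a = i" if "i \<in> set ws" for i
        using that len by (simp add: in_set_conv_nth)
      with ij obtain a b where ab: "a < n" "ws ! a = i" "b < n" "ws ! b = j"
        unfolding ws(2) by meson
      \<comment> \<open>The first vertex of the path links \<open>i\<close> and
        \<open>j\<close>.\<close>
      have "minor i (ws ! 0) \<in> P"
        using ideal_poly_ring_diff[OF ideal' ideal_poly_ring_zero[OF ideal'] *[OF ab(1)]]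
          ab(2) by (simp add: minor_flip[of i "ws ! 0"])
      then show "minor i j \<in> P"
        using *[OF ab(3)] ab(4) ij wn[of 0] assms(1) step[of i "ws ! 0" j] by simp
    qed
    then show ?thesis
      by simp
  qed
  have height_E: "height ?R ?E = prime_height ?R ?I"
    unfolding height_def
  proof (rule antisym)
    show "(INF P\<in>{P \<in> Spec ?R. ?E \<subseteq> P}. prime_height ?R P) \<le> prime_height ?R ?I"
      using Spec_I2 E_I2 by (intro INF_lower) auto
    show "prime_height ?R ?I \<le> (INF P\<in>{P \<in> Spec ?R. ?E \<subseteq> P}. prime_height ?R P)"
    proof (rule INF_greatest)
      fix P assume "P \<in> {P \<in> Spec ?R. ?E \<subseteq> P}"
      then show "prime_height ?R ?I \<le> prime_height ?R P"
        using dichotomy[of P] prime_height_mono[of P ?R ?I] ht_I2 by auto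
    qed
  qed
  have "P = ?I" if P: "P \<in> Spec ?R" "?E \<subseteq> P" "prime_height ?R P = prime_height ?R ?I" for P
  proof (rule ccontr)
    assume "P \<noteq> ?I"
    moreover have "?I \<subseteq> P"
      using dichotomy[OF P(1,2)] P(3) ht_I2 by auto
    ultimately have "prime_height ?R ?I + 1 \<le> prime_height ?R ?I"
      using prime_height_strict[OF Spec_I2 P(1)] P(3) by auto
    \<comment> \<open>An infinite height would satisfy the inequality; that of \<open>I2\<close> is
      finite.\<close>
    then show False
      using ht_I2 by (cases "prime_height ?R ?I") (auto simp: one_enat_def)
  qed
  then show ?thesis
    using Spec_I2 E_I2 height_prime[of _ ?R] height_E by (auto simp: Assh_def)
qed

end
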